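(* Let $[0,1]$ be the real unit interval, and let $G\subseteq\mathbb{Z}^{[0,1]}$ be the additive group of all functions $[0,1]\to\mathbb{Z}$ that are continuous with respect to the fine topology on $[0,1]$ and the discrete topology on $\mathbb{Z}$. For $x\in[0,1]$ let $h_x:G\to\mathbb{Z}$ be the evaluation homomorphism $g\mapsto g(x)$. Then: (1) The group $\mathrm{Hom}(G,\mathbb{Z})$ is free abelian on the generators $h_x$ $(x\in[0,1])$. (2) Hence the group $G_0\subseteq\mathbb{Z}^{[0,1]\cap\mathbb{Q}}$ of functions $[0,1]\cap\mathbb{Q}\to\mathbb{Z}$ obtained by restricting the elements of $G$ to $[0,1]\cap\mathbb{Q}$, which is isomorphic to $G$ via the restriction map, has the same dual; that is, $\mathrm{Hom}(G_0,\mathbb{Z})$ is free abelian on the homomorphisms corresponding under this isomorphism to the $h_x$ $(x\in[0,1])$. (3) Hence $\mathbb{Z}^\omega$ has a subgroup whose dual is free abelian of rank $2^{\aleph_0}$.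
   Context: The dual of an abelian group $A$ is $\mathrm{Hom}(A,\mathbb{Z})$. $\mathbb{Z}^\omega$ denotes the countable direct power of $\mathbb{Z}$. The fine topology on $[0,1]$: a subset $U\subseteq[0,1]$ is open in the fine topology if for every irrational $x\in U$ and every $\varepsilon>0$ there exists $\delta>0$ such that for every closed interval $[r,s]\subseteq[0,1]$ with rational endpoints which contains $x$ and has length $<\delta$, there exists a finite family of pairwise disjoint closed subintervals, also with rational endpoints, which lie in $U\cap[r,s]$ and have total length at least $(1-\varepsilon)(s-r)$. (No condition is imposed at rational points of $U$.) The sets so defined form a topology. *)

theory Defs
  imports "HOL-Analysis.Analysis" "HOL-Algebra.Algebra"
begin

section \<open>The fine topology on the unit interval\<close>

text \<open>
  A finite family of pairwise disjoint closed intervals is given by the finite set of its pairs of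
  endpoints. Degenerate intervals are allowed; they do not contribute to the total length.
\<close>

definition rational_interval_family :: "real set \<Rightarrow> (real \<times> real) set \<Rightarrow> bool" where
  "rational_interval_family S F \<longleftrightarrow>
     finite F \<and>
     (\<forall>(a, b) \<in> F. a \<in> \<rat> \<and> b \<in> \<rat> \<and> a \<le> b \<and> {a..b} \<subseteq> S) \<and>
     disjoint_family_on (\<lambda>(a, b). {a..b}) F"

definition total_length :: "(real \<times> real) set \<Rightarrow> real" where
  "total_length F = (\<Sum>(a, b) \<in> F. b - a)"

definition fine_open :: "real set \<Rightarrow> bool" where
  "fine_open U \<longleftrightarrow> U \<subseteq> {0..1} \<and>
     (\<forall>x \<in> U - \<rat>. \<forall>\<epsilon>>0. \<exists>\<delta>>0. \<forall>r s.
        r \<in> \<rat> \<and> s \<in> \<rat> \<and> {r..s} \<subseteq> {0..1} \<and> x \<in> {r..s} \<and> s - r < \<delta> \<longrightarrow>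
        (\<exists>F. rational_interval_family (U \<inter> {r..s}) F \<and> total_length F \<ge> (1 - \<epsilon>) * (s - r)))"

definition fine_topology :: "real topology" where
  "fine_topology = topology fine_open"

lemma rational_interval_family_mono:
  "rational_interval_family S F \<Longrightarrow> S \<subseteq> T \<Longrightarrow> rational_interval_family T F"
  unfolding rational_interval_family_def by fast

lemma total_length_eq_measure:
  assumes "rational_interval_family S F"
  shows "total_length F = measure lborel (\<Union>(a, b)\<in>F. {a..b})"
proof -
  have "measure lborel (\<Union>p\<in>F. (\<lambda>(a, b). {a..b}) p) = (\<Sum>p\<in>F. measure lborel ((\<lambda>(a, b). {a..b}) p))"
    using assms unfolding rational_interval_family_def
    by (intro measure_finite_Union) (auto simp: image_subset_iff split: if_splits)
  also have "\<dots> = (\<Sum>(a, b)\<in>F. b - a)"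
    using assms unfolding rational_interval_family_def
    by (intro sum.cong) auto
  finally show ?thesis by (simp add: total_length_def)
qed

lemma rational_interval_family_Int:
  assumes F: "rational_interval_family (S \<inter> {r..s}) F"
    and F': "rational_interval_family (T \<inter> {r..s}) F'"
    and rs: "r \<le> s"
  shows "\<exists>H. rational_interval_family (S \<inter> T \<inter> {r..s}) H \<and>
             total_length H \<ge> total_length F + total_length F' - (s - r)"
proof -
  define m where "m = (\<lambda>p q :: real \<times> real. (max (fst p) (fst q), min (snd p) (snd q)))"
  define H where "H = (\<lambda>(p, q). m p q) ` {(p, q) \<in> F \<times> F'. fst (m p q) \<le> snd (m p q)}"
  define I where "I = (\<lambda>(a, b). {a..b :: real})"
  have m: "I (m p q) = I p \<inter> I q" for p q
    by (auto simp: m_def I_def split: prod.splits)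
  have fin: "finite F" "finite F'"
    using F F' by (auto simp: rational_interval_family_def)
  have disj: "disjoint_family_on I F" "disjoint_family_on I F'"
    using F F' by (auto simp: rational_interval_family_def I_def)
  have el: "fst p \<in> \<rat> \<and> snd p \<in> \<rat> \<and> I p \<subseteq> S \<inter> {r..s}" if "p \<in> F" for p
    using F that by (force simp: rational_interval_family_def I_def split: prod.splits)
  have el': "fst p \<in> \<rat> \<and> snd p \<in> \<rat> \<and> I p \<subseteq> T \<inter> {r..s}" if "p \<in> F'" for p
    using F' that by (force simp: rational_interval_family_def I_def split: prod.splits)
  have H: "rational_interval_family (S \<inter> T \<inter> {r..s}) H"
    unfolding rational_interval_family_def
  proof (intro conjI)
    have "finite (F \<times> F')" using fin by simp
    then have "finite {(p, q) \<in> F \<times> F'. fst (m p q) \<le> snd (m p q)}"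
      by (rule rev_finite_subset) auto
    then show "finite H" unfolding H_def by (rule finite_imageI)
    show "\<forall>(a, b)\<in>H. a \<in> \<rat> \<and> b \<in> \<rat> \<and> a \<le> b \<and> {a..b} \<subseteq> S \<inter> T \<inter> {r..s}"
    proof (clarify)
      fix a b assume "(a, b) \<in> H"
      then have "\<exists>p q. p \<in> F \<and> q \<in> F' \<and> fst (m p q) \<le> snd (m p q) \<and> m p q = (a, b)"
        unfolding H_def by force
      then obtain p q where pq: "p \<in> F" "q \<in> F'" "fst (m p q) \<le> snd (m p q)" "m p q = (a, b)"
        by blast
      have "{a..b} = I p \<inter> I q"
        using m[of p q] pq(4) by (simp add: I_def)
      moreover have "a \<in> \<rat>" "b \<in> \<rat>"
        using pq el[of p] el'[of q] by (auto simp: m_def max_def min_def split: if_splits)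
      ultimately show "a \<in> \<rat> \<and> b \<in> \<rat> \<and> a \<le> b \<and> {a..b} \<subseteq> S \<inter> T \<inter> {r..s}"
        using pq el[of p] el'[of q] by auto
    qed
    have "disjoint_family_on I H"
      unfolding disjoint_family_on_def
    proof (intro ballI impI)
      fix u v assume "u \<in> H" "v \<in> H" "u \<noteq> v"
      then obtain p q p' q' where *: "p \<in> F" "q \<in> F'" "u = m p q" "p' \<in> F" "q' \<in> F'" "v = m p' q'"
        by (auto simp: H_def)
      then have "p \<noteq> p' \<or> q \<noteq> q'" using \<open>u \<noteq> v\<close> by auto
      then have "I p \<inter> I p' = {} \<or> I q \<inter> I q' = {}"
        using disj *(1,2,4,5) unfolding disjoint_family_on_def by metis
      then show "I u \<inter> I v = {}" using * m by auto
    qed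
    then show "disjoint_family_on (\<lambda>(a, b). {a..b}) H" by (simp add: I_def)
  qed
  define A where "A = (\<Union>p\<in>F. I p)"
  define B where "B = (\<Union>p\<in>F'. I p)"
  have AB: "(\<Union>p\<in>H. I p) = A \<inter> B"
  proof
    show "(\<Union>p\<in>H. I p) \<subseteq> A \<inter> B"
      by (auto simp: H_def A_def B_def m)
    show "A \<inter> B \<subseteq> (\<Union>p\<in>H. I p)"
    proof
      fix z assume "z \<in> A \<inter> B"
      then obtain p q where *: "p \<in> F" "q \<in> F'" "z \<in> I (m p q)"
        by (auto simp: A_def B_def m)
      then have "fst (m p q) \<le> snd (m p q)" by (auto simp: I_def split: prod.splits)
      then have "m p q \<in> H" using * by (auto simp: H_def)
      then show "z \<in> (\<Union>p\<in>H. I p)" using * by auto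
    qed
  qed
  have comp: "compact A" "compact B"
    using fin by (auto simp: A_def B_def I_def intro!: compact_UN split: prod.splits)
  have sub: "A \<union> B \<subseteq> {r..s}" using el el' unfolding A_def B_def by blast
  have fm: "A \<in> fmeasurable lborel" "B \<in> fmeasurable lborel"
    using comp by (auto intro: fmeasurable_compact)
  have "measure lborel (A \<union> B) = measure lborel A + measure lborel B - measure lborel (A \<inter> B)"
    using measure_Un3[OF fm] by simp
  moreover have "measure lborel (A \<union> B) \<le> measure lborel {r..s}"
    using sub fmeasurableD[OF fm(1)] fmeasurableD[OF fm(2)] fmeasurable_compact[of "{r..s}"]
    by (intro measure_mono_fmeasurable) auto
  ultimately have "measure lborel (A \<inter> B) \<ge> measure lborel A + measure lborel B - (s - r)"
    using rs by simp
  then have "total_length H \<ge> total_length F + total_length F' - (s - r)"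
    using total_length_eq_measure[OF H] total_length_eq_measure[OF F] total_length_eq_measure[OF F'] AB
    by (simp add: A_def B_def I_def)
  with H show ?thesis by blast
qed

lemma istopology_fine_open: "istopology fine_open"
  unfolding istopology_def
proof (intro conjI allI impI)
  fix S T assume S: "fine_open S" and T: "fine_open T"
  show "fine_open (S \<inter> T)"
    unfolding fine_open_def
  proof (intro conjI ballI allI impI)
    show "S \<inter> T \<subseteq> {0..1}" using S by (auto simp: fine_open_def)
    fix x \<epsilon> :: real assume x: "x \<in> S \<inter> T - \<rat>" and "\<epsilon> > 0"
    then have e: "\<epsilon> / 2 > 0" and xS: "x \<in> S - \<rat>" and xT: "x \<in> T - \<rat>" by auto
    from S[unfolded fine_open_def] xS e obtain d where d: "d > 0"
      "\<And>r s. r \<in> \<rat> \<and> s \<in> \<rat> \<and> {r..s} \<subseteq> {0..1} \<and> x \<in> {r..s} \<and> s - r < d \<Longrightarrow>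
        \<exists>F. rational_interval_family (S \<inter> {r..s}) F \<and> total_length F \<ge> (1 - \<epsilon> / 2) * (s - r)"
      by meson
    from T[unfolded fine_open_def] xT e obtain d' where d': "d' > 0"
      "\<And>r s. r \<in> \<rat> \<and> s \<in> \<rat> \<and> {r..s} \<subseteq> {0..1} \<and> x \<in> {r..s} \<and> s - r < d' \<Longrightarrow>
        \<exists>F. rational_interval_family (T \<inter> {r..s}) F \<and> total_length F \<ge> (1 - \<epsilon> / 2) * (s - r)"
      by meson
    have "\<exists>H. rational_interval_family (S \<inter> T \<inter> {r..s}) H \<and> total_length H \<ge> (1 - \<epsilon>) * (s - r)"
      if rs: "r \<in> \<rat> \<and> s \<in> \<rat> \<and> {r..s} \<subseteq> {0..1} \<and> x \<in> {r..s} \<and> s - r < min d d'" for r s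
    proof -
      obtain F where F: "rational_interval_family (S \<inter> {r..s}) F" "total_length F \<ge> (1 - \<epsilon> / 2) * (s - r)"
        using d(2)[of r s] rs by auto
      obtain F' where F': "rational_interval_family (T \<inter> {r..s}) F'" "total_length F' \<ge> (1 - \<epsilon> / 2) * (s - r)"
        using d'(2)[of r s] rs by auto
      obtain H where H: "rational_interval_family (S \<inter> T \<inter> {r..s}) H"
        "total_length H \<ge> total_length F + total_length F' - (s - r)"
        using rational_interval_family_Int[OF F(1) F'(1)] rs by auto
      have "(1 - \<epsilon> / 2) * (s - r) + (1 - \<epsilon> / 2) * (s - r) - (s - r) = (1 - \<epsilon>) * (s - r)"
        by (simp add: field_simps)
      then have "total_length H \<ge> (1 - \<epsilon>) * (s - r)"
        using F(2) F'(2) H(2) by linarith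
      with H(1) show ?thesis by blast
    qed
    then show "\<exists>\<delta>>0. \<forall>r s. r \<in> \<rat> \<and> s \<in> \<rat> \<and> {r..s} \<subseteq> {0..1} \<and> x \<in> {r..s} \<and> s - r < \<delta> \<longrightarrow>
        (\<exists>F. rational_interval_family (S \<inter> T \<inter> {r..s}) F \<and> (1 - \<epsilon>) * (s - r) \<le> total_length F)"
      using d(1) d'(1) by (intro exI[of _ "min d d'"]) auto
  qed
next
  fix K assume K: "\<forall>U\<in>K. fine_open U"
  show "fine_open (\<Union>K)"
    unfolding fine_open_def
  proof (intro conjI ballI allI impI)
    show "\<Union>K \<subseteq> {0..1}" using K by (auto simp: fine_open_def)
    fix x \<epsilon> :: real assume x: "x \<in> \<Union>K - \<rat>" and e: "\<epsilon> > 0"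
    then obtain U where U: "U \<in> K" "x \<in> U - \<rat>" by auto
    then have "fine_open U" using K by auto
    from this[unfolded fine_open_def] U(2) e obtain d where d: "d > 0"
      "\<And>r s. r \<in> \<rat> \<and> s \<in> \<rat> \<and> {r..s} \<subseteq> {0..1} \<and> x \<in> {r..s} \<and> s - r < d \<Longrightarrow>
        \<exists>F. rational_interval_family (U \<inter> {r..s}) F \<and> total_length F \<ge> (1 - \<epsilon>) * (s - r)"
      by meson
    have "U \<inter> {r..s} \<subseteq> \<Union>K \<inter> {r..s}" for r s using U(1) by auto
    then show "\<exists>\<delta>>0. \<forall>r s. r \<in> \<rat> \<and> s \<in> \<rat> \<and> {r..s} \<subseteq> {0..1} \<and> x \<in> {r..s} \<and> s - r < \<delta> \<longrightarrow>
        (\<exists>F. rational_interval_family (\<Union>K \<inter> {r..s}) F \<and> (1 - \<epsilon>) * (s - r) \<le> total_length F)"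
      using d rational_interval_family_mono by meson
  qed
qed

lemma openin_fine_topology: "openin fine_topology U \<longleftrightarrow> fine_open U"
  by (simp add: fine_topology_def istopology_fine_open)

lemma topspace_fine_topology: "topspace fine_topology = {0..1}"
proof -
  have "fine_open {0..1}"
    unfolding fine_open_def
  proof (intro conjI ballI allI impI)
    fix x \<epsilon> :: real assume e: "\<epsilon> > 0"
    have "rational_interval_family ({0..1} \<inter> {r..s}) {(r, s)} \<and> (1 - \<epsilon>) * (s - r) \<le> total_length {(r, s)}"
      if "r \<in> \<rat>" "s \<in> \<rat>" "{r..s} \<subseteq> {0..1}" "x \<in> {r..s}" for r s
      using that e
      by (auto simp: rational_interval_family_def total_length_def disjoint_family_on_def
          algebra_simps mult_left_mono)
    then have "\<exists>F. rational_interval_family ({0..1} \<inter> {r..s}) F \<and> (1 - \<epsilon>) * (s - r) \<le> total_length F"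
      if "r \<in> \<rat> \<and> s \<in> \<rat> \<and> {r..s} \<subseteq> {0..1} \<and> x \<in> {r..s} \<and> s - r < 1" for r s
      using that by (intro exI[of _ "{(r, s)}"]) simp
    then show "\<exists>\<delta>>0. \<forall>r s. r \<in> \<rat> \<and> s \<in> \<rat> \<and> {r..s} \<subseteq> {0..1} \<and> x \<in> {r..s} \<and> s - r < \<delta> \<longrightarrow>
        (\<exists>F. rational_interval_family ({0..1} \<inter> {r..s}) F \<and> (1 - \<epsilon>) * (s - r) \<le> total_length F)"
      using zero_less_one by (intro exI[of _ "1::real"] conjI allI impI)
  qed simp
  then show ?thesis
    unfolding topspace_def openin_fine_topology using fine_open_def by blast
qed

section \<open>Duals and free abelian groups\<close>

text \<open>
  Homomorphisms out of \<open>A\<close> are taken to be \<open>undefined\<close> outside the carrier, so that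
  two of them are equal iff they agree on the carrier.
\<close>

definition dual_group :: "('a, 'm) monoid_scheme \<Rightarrow> ('a \<Rightarrow> int) monoid" where
  "dual_group A =
     \<lparr>carrier = hom A integer_group \<inter> extensional (carrier A),
      monoid.mult = (\<lambda>f g. \<lambda>a\<in>carrier A. f a + g a),
      one = (\<lambda>a\<in>carrier A. 0)\<rparr>"

text \<open>\<open>A\<close> is free abelian on the elements \<open>b i\<close> for \<open>i \<in> I\<close>; in particular, these are distinct.\<close>

definition free_abelian_on :: "('a, 'm) monoid_scheme \<Rightarrow> 'i set \<Rightarrow> ('i \<Rightarrow> 'a) \<Rightarrow> bool" where
  "free_abelian_on A I b \<longleftrightarrow>
     (\<exists>\<phi> \<in> iso (free_Abelian_group I) A. \<forall>i \<in> I. \<phi> (frag_of i) = b i)"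

lemma comm_group_dual_group:
  assumes "group A"
  shows "comm_group (dual_group A)"
proof -
  interpret group A by fact
  show ?thesis
  proof (rule comm_groupI)
    fix f assume "f \<in> carrier (dual_group A)"
    then show "\<exists>g\<in>carrier (dual_group A). g \<otimes>\<^bsub>dual_group A\<^esub> f = \<one>\<^bsub>dual_group A\<^esub>"
      by (intro bexI[of _ "\<lambda>a\<in>carrier A. - f a"])
        (auto simp: dual_group_def hom_def integer_group_def)
  qed (auto simp: dual_group_def hom_def integer_group_def extensional_def restrict_def fun_eq_iff)
qed

section \<open>The groups of functions\<close>

definition int_power :: "'i set \<Rightarrow> ('i \<Rightarrow> int) monoid" where
  "int_power I = product_group I (\<lambda>_. integer_group)"

definition fine_group :: "(real \<Rightarrow> int) monoid" where
  "fine_group = (int_power {0..1})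
     \<lparr>carrier := {g \<in> carrier (int_power {0..1}).
        continuous_map fine_topology (discrete_topology UNIV) g}\<rparr>"

definition eval_hom :: "real \<Rightarrow> (real \<Rightarrow> int) \<Rightarrow> int" where
  "eval_hom x = (\<lambda>g \<in> carrier fine_group. g x)"

text \<open>Functions are \<open>undefined\<close> outside their domain, here \<open>[0,1] \<inter> \<rat>\<close>.\<close>

definition restr_rat :: "(real \<Rightarrow> int) \<Rightarrow> real \<Rightarrow> int" where
  "restr_rat g = restrict g ({0..1} \<inter> \<rat>)"

definition fine_group_rat :: "(real \<Rightarrow> int) monoid" where
  "fine_group_rat = (int_power ({0..1} \<inter> \<rat>))\<lparr>carrier := restr_rat ` carrier fine_group\<rparr>"

text \<open>
  The homomorphism that corresponds to \<open>eval_hom x\<close> under the bijection \<open>restr_rat\<close>; note that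
  \<open>x\<close> may be irrational.
\<close>

definition eval_hom_rat :: "real \<Rightarrow> (real \<Rightarrow> int) \<Rightarrow> int" where
  "eval_hom_rat x = (\<lambda>f \<in> carrier fine_group_rat. eval_hom x (inv_into (carrier fine_group) restr_rat f))"

lemma subgroup_fine_group: "subgroup (carrier fine_group) (int_power {0..1})"
proof -
  have cont: "continuous_map fine_topology (discrete_topology UNIV) (\<lambda>x\<in>{0..1}. \<phi> (f x) (g x))"
    if f: "continuous_map fine_topology (discrete_topology UNIV) f"
      and g: "continuous_map fine_topology (discrete_topology UNIV) g"
    for f g :: "real \<Rightarrow> int" and \<phi> :: "int \<Rightarrow> int \<Rightarrow> int"
  proof -
    have "continuous_map fine_topology (discrete_topology (UNIV \<times> UNIV)) (\<lambda>x. (f x, g x))"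
      using f g unfolding prod_topology_discrete_topology by (simp add: continuous_map_pairedI)
    moreover have "continuous_map (discrete_topology (UNIV \<times> UNIV)) (discrete_topology UNIV) (case_prod \<phi>)"
      by simp
    ultimately have "continuous_map fine_topology (discrete_topology UNIV) (case_prod \<phi> \<circ> (\<lambda>x. (f x, g x)))"
      by (rule continuous_map_compose)
    then show ?thesis
      by (rule continuous_map_eq) (simp add: topspace_fine_topology)
  qed
  have inv: "inv\<^bsub>int_power {0..1}\<^esub> f = (\<lambda>x\<in>{0..1}. - f x)" if "f \<in> carrier (int_power {0..1})"
    for f :: "real \<Rightarrow> int"
    using that by (auto simp: int_power_def inv_product_group inv_integer_group)
  interpret group "int_power {0..1 :: real}" by (simp add: int_power_def)
  show ?thesis
  proof (rule subgroupI)
    show "carrier fine_group \<noteq> {}"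
      using cont[of "\<lambda>_. 0" "\<lambda>_. 0" "\<lambda>_ _. 0"]
      by (auto simp: fine_group_def int_power_def intro!: exI[of _ "\<lambda>x\<in>{0..1}. 0"])
    fix f assume f: "f \<in> carrier fine_group"
    then show "inv\<^bsub>int_power {0..1}\<^esub> f \<in> carrier fine_group"
      using cont[of f f "\<lambda>a b. - a"] inv[of f] by (auto simp: fine_group_def int_power_def)
    fix g assume "g \<in> carrier fine_group"
    then show "f \<otimes>\<^bsub>int_power {0..1}\<^esub> g \<in> carrier fine_group"
      using f cont[of f g "(+)"] by (auto simp: fine_group_def int_power_def integer_group_def)
  qed (auto simp: fine_group_def)
qed

lemma subgroup_fine_group_rat: "subgroup (carrier fine_group_rat) (int_power ({0..1} \<inter> \<rat>))"
proof -
  have "restr_rat \<in> hom (int_power {0..1}) (int_power ({0..1} \<inter> \<rat>))"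
    by (auto simp: hom_def restr_rat_def int_power_def integer_group_def)
  then have "group_hom (int_power {0..1}) (int_power ({0..1} \<inter> \<rat>)) restr_rat"
    by (simp add: group_hom_def group_hom_axioms_def int_power_def)
  from group_hom.subgroup_img_is_subgroup[OF this subgroup_fine_group] show ?thesis
    by (simp add: fine_group_rat_def)
qed

end

theory Submission
  imports Defs
begin

text \<open>
  Let \<open>\<Phi>\<close> be a homomorphism from \<open>G\<close> to the integers. Rational intervals are clopen, so functions
  in \<open>G\<close> can be cut at rational points. If \<open>y n\<close> converges to \<open>x\<close> and \<open>f n\<close> in \<open>G\<close> is supported in an
  interval around \<open>y n\<close> much shorter than \<open>\<bar>y n - x\<bar>\<close>, then every infinite combination of the \<open>f n\<close> is
  again in \<open>G\<close>: the union of the supports has density 0 at \<open>x\<close>. By Specker's theorem \<open>\<Phi>\<close> kills almost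
  all \<open>f n\<close>; hence, near \<open>x\<close>, it kills every function supported in a compact set avoiding \<open>x\<close>.
  A function \<open>g\<close> with \<open>g x = 0\<close> vanishes on a fine neighbourhood of \<open>x\<close>, so cutting it into shells
  around \<open>x\<close> gives another family all of whose combinations lie in \<open>G\<close>, and Specker's theorem
  shows that \<open>\<Phi>\<close> kills \<open>g\<close> if its support is close to \<open>x\<close>. So \<open>\<Phi>\<close> is locally a multiple of an
  evaluation, and globally a finite combination of evaluations by compactness of the unit interval.
\<close>

section \<open>Additive functionals on sequences of integers\<close>

lemma additive_int_eq_mult:
  fixes f :: "int \<Rightarrow> int"
  assumes "\<And>a b. f (a + b) = f a + f b"
  shows "f k = k * f 1"
proof -
  have 0: "f 0 = 0" using assms[of 0 0] by simp
  show ?thesis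
  proof (induction k rule: int_induct[where k = 0])
    case (step1 i) then show ?case by (simp add: assms distrib_right)
  next
    case (step2 i) then show ?case using assms[of "i - 1" 1] by (simp add: left_diff_distrib)
  qed (simp add: 0)
qed

text \<open>The goal is Specker's theorem: a homomorphism from the countable power of the integers
  to the integers depends on finitely many coordinates only.\<close>

locale additive_on_sequences =
  fixes \<Psi> :: "(nat \<Rightarrow> int) \<Rightarrow> int"
  assumes add: "\<Psi> (\<lambda>n. a n + b n) = \<Psi> a + \<Psi> b"
begin

abbreviation t :: "nat \<Rightarrow> int" where
  "t i \<equiv> \<Psi> (\<lambda>n. if n = i then 1 else 0)"

lemma scale: "\<Psi> (\<lambda>n. k * a n) = k * \<Psi> a"
  using additive_int_eq_mult[of "\<lambda>k. \<Psi> (\<lambda>n. k * a n)" k] by (simp add: distrib_right add)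

lemma head_tail: "\<Psi> c = (\<Sum>i<k. c i * t i) + \<Psi> (\<lambda>n. if n < k then 0 else c n)"
proof (induction k)
  case (Suc k)
  have "(\<lambda>n. if n < k then 0 else c n) =
      (\<lambda>n. c k * (if n = k then 1 else 0) + (if n < Suc k then 0 else c n))"
    by (auto simp: fun_eq_iff less_Suc_eq)
  then have "\<Psi> (\<lambda>n. if n < k then 0 else c n) =
      c k * t k + \<Psi> (\<lambda>n. if n < Suc k then 0 else c n)"
    by (simp only: add scale)
  with Suc.IH show ?case by simp
qed simp

text \<open>Dividing the tail coordinatewise by \<open>m\<close> leaves an integer sequence, and
  \<open>scale\<close> pulls the factor out of \<open>\<Psi>\<close>.\<close>

lemma dvd_tail:
  assumes "\<And>n. n \<ge> k \<Longrightarrow> m dvd c n"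
  shows "m dvd \<Psi> (\<lambda>n. if n < k then 0 else c n)"
proof -
  have "(\<lambda>n. if n < k then 0 else c n) = (\<lambda>n. m * (if n < k then 0 else c n div m))"
    using assms by (auto simp: fun_eq_iff)
  then have "\<Psi> (\<lambda>n. if n < k then 0 else c n) = m * \<Psi> (\<lambda>n. if n < k then 0 else c n div m)"
    by (simp only: scale)
  then show ?thesis by simp
qed

text \<open>Evaluate \<open>\<Psi>\<close> on a fast growing sequence \<open>M\<close> whose terms
  divide all later ones. The partial sum \<open>s k\<close> is congruent to \<open>\<Psi> M\<close>
  modulo \<open>M k\<close> and at most half of \<open>M k\<close> in absolute value, so it equals
  \<open>\<Psi> M\<close> once \<open>M k\<close> is large. Then consecutive partial sums agree,
  which forces \<open>M k * t k = 0\<close>.\<close>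

lemma eventually_zero_on_units: "\<exists>N. \<forall>i\<ge>N. t i = 0"
proof -
  \<comment> \<open>The factor absorbs \<open>\<bar>t i\<bar>\<close>: adding
    \<open>M i * t i\<close> to the partial sum keeps it within half of the next term.\<close>
  define M where "M k = (\<Prod>i<k. 3 * (1 + \<bar>t i\<bar>))" for k
  define s where "s k = (\<Sum>i<k. M i * t i)" for k
  have M_Suc: "M (Suc k) = 3 * (1 + \<bar>t k\<bar>) * M k" for k by (simp add: M_def)
  have M_ge: "int k < M k" for k
  proof (induction k)
    case (Suc k)
    have "1 * M k \<le> (1 + \<bar>t k\<bar>) * M k" using Suc by (intro mult_right_mono) auto
    moreover have "M (Suc k) = 3 * ((1 + \<bar>t k\<bar>) * M k)" by (simp add: M_Suc)
    ultimately show ?case using Suc by linarith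
  qed (simp add: M_def)
  have M_dvd: "M k dvd M n" if "k \<le> n" for k n
    unfolding M_def using that by (intro prod_dvd_prod_subset) auto
  \<comment> \<open>\<open>M k\<close> outgrows the partial sum \<open>s k\<close>, but divides its distance to \<open>\<Psi> M\<close>.\<close>
  have s_le: "2 * \<bar>s k\<bar> \<le> M k" for k
  proof (induction k)
    case (Suc k)
    have "\<bar>s (Suc k)\<bar> \<le> \<bar>s k\<bar> + \<bar>M k * t k\<bar>" by (simp add: s_def)
    also have "\<bar>M k * t k\<bar> = M k * \<bar>t k\<bar>" using M_ge[of k] by (simp add: abs_mult)
    finally have "2 * \<bar>s (Suc k)\<bar> \<le> M k + 2 * (M k * \<bar>t k\<bar>)" using Suc by linarith
    moreover have "0 \<le> M k * \<bar>t k\<bar>" "0 \<le> M k" using M_ge[of k] by auto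
    ultimately show ?case unfolding M_Suc by (simp add: algebra_simps)
  qed (simp add: s_def M_def)
  have dvd: "M k dvd \<Psi> M - s k" for k
    using head_tail[of M k] dvd_tail[of k "M k" M] M_dvd by (simp add: s_def)
  \<comment> \<open>The threshold and \<open>k < M k\<close> put \<open>\<Psi> M\<close> strictly
    within half of \<open>M k\<close> of 0, so the difference is a multiple of \<open>M k\<close>
    smaller than \<open>M k\<close>.\<close>
  have eq: "\<Psi> M = s k" if "k \<ge> nat (2 * \<bar>\<Psi> M\<bar>)" for k
  proof -
    have "\<bar>\<Psi> M - s k\<bar> < M k" using s_le[of k] M_ge[of k] that by linarith
    then show ?thesis using dvd[of k] zdvd_not_zless[of "\<bar>\<Psi> M - s k\<bar>" "M k"] by fastforce
  qed
  have "t k = 0" if "k \<ge> nat (2 * \<bar>\<Psi> M\<bar>)" for k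
  proof -
    have "s (Suc k) = s k" using eq[of k] eq[of "Suc k"] that by simp
    then show ?thesis using M_ge[of k] by (simp add: s_def)
  qed
  then show ?thesis by blast
qed

text \<open>The first \<open>k\<close> coordinates contribute 0 and the tail contributes a multiple
  of \<open>m ^ k\<close>; only 0 is divisible by all powers of \<open>m\<close>.\<close>

lemma zero_on_multiples_of_powers:
  assumes "\<And>i. a i * t i = 0" and "m > 1"
  shows "\<Psi> (\<lambda>n. m ^ n * a n) = 0"
proof -
  have dvd: "m ^ k dvd \<Psi> (\<lambda>n. m ^ n * a n)" for k
  proof -
    have "(\<Sum>i<k. (m ^ i * a i) * t i) = 0" using assms(1) by (intro sum.neutral) auto
    then show ?thesis
      using head_tail[of "\<lambda>n. m ^ n * a n" k] dvd_tail[of k "m ^ k" "\<lambda>n. m ^ n * a n"]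
      by (simp add: le_imp_power_dvd)
  qed
  show ?thesis
  proof (rule ccontr)
    assume nz: "\<Psi> (\<lambda>n. m ^ n * a n) \<noteq> 0" (is "?V \<noteq> 0")
    have "int k < m ^ k" for k
    proof -
      have "int k < 2 ^ k" by (simp add: of_nat_less_two_power)
      also have "\<dots> \<le> m ^ k" using assms(2) by (intro power_mono) auto
      finally show ?thesis .
    qed
    from this[of "nat \<bar>?V\<bar>"] have "\<bar>?V\<bar> < m ^ nat \<bar>?V\<bar>" by simp
    moreover have "m ^ nat \<bar>?V\<bar> \<le> \<bar>?V\<bar>"
      using dvd[of "nat \<bar>?V\<bar>"] nz by (intro zdvd_imp_le) auto
    ultimately show False by simp
  qed
qed

text \<open>
  A sequence is the sum of one whose \<open>n\<close>-th term is divisible by \<open>2 ^ n\<close> and one whose \<open>n\<close>-th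
  term is divisible by \<open>3 ^ n\<close>.
\<close>

theorem zero_on_tails: "\<exists>N. \<forall>c. (\<forall>n<N. c n = 0) \<longrightarrow> \<Psi> c = 0"
proof -
  obtain N where N: "\<And>i. i \<ge> N \<Longrightarrow> t i = 0" using eventually_zero_on_units by blast
  have "\<Psi> c = 0" if c: "\<And>n. n < N \<Longrightarrow> c n = 0" for c
  proof -
    have "\<exists>u v. u * 2 ^ n + v * 3 ^ n = (1::int)" for n
    proof -
      have "coprime ((2::int) ^ n) (3 ^ n)" by simp
      then show ?thesis using bezout_int[of "2 ^ n" "3 ^ n"] by (simp del: coprime_power_left_iff coprime_power_right_iff)
    qed
    then obtain u v where uv: "\<And>n. u n * 2 ^ n + v n * 3 ^ n = (1::int)" by metis
    have "c n = 2 ^ n * (u n * c n) + 3 ^ n * (v n * c n)" for n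
    proof -
      have "c n = (u n * 2 ^ n + v n * 3 ^ n) * c n" by (simp only: uv)
      then show ?thesis by (simp add: algebra_simps)
    qed
    then have "\<Psi> c = \<Psi> (\<lambda>n. 2 ^ n * (u n * c n) + 3 ^ n * (v n * c n))" by presburger
    also have "\<dots> = 0"
    proof -
      \<comment> \<open>Below \<open>N\<close> the factor \<open>c i\<close> vanishes, from
        \<open>N\<close> on the factor \<open>t i\<close>.\<close>
      have "w i * c i * t i = 0" for w i using N[of i] c[of i] by (cases "i < N") auto
      then show ?thesis unfolding add by (simp add: zero_on_multiples_of_powers)
    qed
    finally show ?thesis .
  qed
  then show ?thesis by blast
qed

end

section \<open>Continuity in the fine topology\<close>

text \<open>The condition of \<open>fine_open\<close> isolated at one point. Neither
  \<open>x \<in> U\<close> nor \<open>U \<subseteq> {0..1}\<close> is built in, so it applies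
  directly to level sets of functions on the reals.\<close>

definition thick_at :: "real \<Rightarrow> real set \<Rightarrow> bool" where
  "thick_at x U \<longleftrightarrow> (\<forall>\<epsilon>>0. \<exists>\<delta>>0. \<forall>r s.
     r \<in> \<rat> \<and> s \<in> \<rat> \<and> {r..s} \<subseteq> {0..1} \<and> x \<in> {r..s} \<and> s - r < \<delta> \<longrightarrow>
     (\<exists>F. rational_interval_family (U \<inter> {r..s}) F \<and> total_length F \<ge> (1 - \<epsilon>) * (s - r)))"

lemma fine_open_iff_thick_at: "fine_open U \<longleftrightarrow> U \<subseteq> {0..1} \<and> (\<forall>x\<in>U - \<rat>. thick_at x U)"
  by (simp add: fine_open_def thick_at_def)

text \<open>Thickness is local: with \<open>\<delta>\<close> at most \<open>\<eta>\<close>, every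
  interval to be tested stays within distance \<open>\<eta>\<close> of \<open>x\<close>.\<close>

lemma thick_at_mono_near:
  assumes "thick_at x U" "\<eta> > 0" and sub: "\<And>y. y \<in> U \<Longrightarrow> y \<in> {0..1} \<Longrightarrow> \<bar>y - x\<bar> < \<eta> \<Longrightarrow> y \<in> V"
  shows "thick_at x V"
  unfolding thick_at_def
proof (intro allI impI)
  fix \<epsilon> :: real assume "\<epsilon> > 0"
  then obtain \<delta> where \<delta>: "\<delta> > 0"
    "\<And>r s. r \<in> \<rat> \<and> s \<in> \<rat> \<and> {r..s} \<subseteq> {0..1} \<and> x \<in> {r..s} \<and> s - r < \<delta> \<Longrightarrow>
      \<exists>F. rational_interval_family (U \<inter> {r..s}) F \<and> total_length F \<ge> (1 - \<epsilon>) * (s - r)"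
    using assms(1) unfolding thick_at_def by meson
  have "\<exists>F. rational_interval_family (V \<inter> {r..s}) F \<and> total_length F \<ge> (1 - \<epsilon>) * (s - r)"
    if rs: "r \<in> \<rat> \<and> s \<in> \<rat> \<and> {r..s} \<subseteq> {0..1} \<and> x \<in> {r..s} \<and> s - r < min \<delta> \<eta>" for r s
  proof -
    have "U \<inter> {r..s} \<subseteq> V \<inter> {r..s}"
    proof
      fix y assume "y \<in> U \<inter> {r..s}"
      then show "y \<in> V \<inter> {r..s}" using rs sub[of y] by auto
    qed
    then show ?thesis using \<delta>(2)[of r s] rs rational_interval_family_mono by (meson min_less_iff_conj)
  qed
  then show "\<exists>\<delta>>0. \<forall>r s. r \<in> \<rat> \<and> s \<in> \<rat> \<and> {r..s} \<subseteq> {0..1} \<and> x \<in> {r..s} \<and> s - r < \<delta> \<longrightarrow>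
     (\<exists>F. rational_interval_family (V \<inter> {r..s}) F \<and> total_length F \<ge> (1 - \<epsilon>) * (s - r))"
    using \<delta>(1) \<open>\<eta> > 0\<close> by (intro exI[of _ "min \<delta> \<eta>"]) auto
qed

lemma thick_at_mono: "thick_at x U \<Longrightarrow> U \<subseteq> V \<Longrightarrow> thick_at x V"
  by (rule thick_at_mono_near[where U = U and \<eta> = 1]) auto

abbreviation fine_cont :: "(real \<Rightarrow> int) \<Rightarrow> bool" where
  "fine_cont g \<equiv> continuous_map fine_topology (discrete_topology UNIV) g"

text \<open>The preimage of a set of values contains the level set through each of its points, so
  thickness of level sets suffices. Rational points carry no condition.\<close>

lemma fine_cont_iff: "fine_cont g \<longleftrightarrow> (\<forall>x. x \<notin> \<rat> \<longrightarrow> thick_at x {y. g y = g x})"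
proof
  assume g: "fine_cont g"
  show "\<forall>x. x \<notin> \<rat> \<longrightarrow> thick_at x {y. g y = g x}"
  proof (intro allI impI)
    fix x :: real assume x: "x \<notin> \<rat>"
    show "thick_at x {y. g y = g x}"
    proof (cases "x \<in> {0..1}")
      case True
      have "openin fine_topology {y \<in> topspace fine_topology. g y \<in> {g x}}"
        using g by (rule openin_continuous_map_preimage) simp
      then have "thick_at x {y \<in> {0..1}. g y \<in> {g x}}"
        using True x by (simp add: openin_fine_topology topspace_fine_topology fine_open_iff_thick_at)
      then show ?thesis by (rule thick_at_mono) auto
    next
      case False
      \<comment> \<open>Outside the unit interval the condition is vacuous, since no interval to be
        tested contains \<open>x\<close>.\<close>
      then show ?thesis unfolding thick_at_def by (intro allI impI exI[of _ 1]) auto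
    qed
  qed
next
  assume g: "\<forall>x. x \<notin> \<rat> \<longrightarrow> thick_at x {y. g y = g x}"
  have "fine_open {x \<in> {0..1}. g x \<in> U}" for U
    unfolding fine_open_iff_thick_at
  proof (intro conjI ballI)
    fix x assume "x \<in> {x \<in> {0..1}. g x \<in> U} - \<rat>"
    then show "thick_at x {x \<in> {0..1}. g x \<in> U}"
      using g by - (rule thick_at_mono_near[of x "{y. g y = g x}" 1], auto)
  qed auto
  then show "fine_cont g"
    unfolding continuous_map_def openin_fine_topology topspace_fine_topology by simp
qed

lemma fine_cont_const [simp]: "fine_cont (\<lambda>_. k)"
  by simp

lemma fine_cont_binop:
  assumes "fine_cont f" "fine_cont g"
  shows "fine_cont (\<lambda>z. \<phi> (f z) (g z))"
proof -
  have "continuous_map fine_topology (discrete_topology (UNIV \<times> UNIV)) (\<lambda>x. (f x, g x))"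
    using assms unfolding prod_topology_discrete_topology by (simp add: continuous_map_pairedI)
  moreover have "continuous_map (discrete_topology (UNIV \<times> UNIV)) (discrete_topology UNIV) (case_prod \<phi>)"
    by simp
  ultimately have "fine_cont (case_prod \<phi> \<circ> (\<lambda>x. (f x, g x)))"
    by (rule continuous_map_compose)
  then show ?thesis by (simp add: o_def)
qed

lemmas fine_cont_add = fine_cont_binop[where \<phi> = "(+)"]
  and fine_cont_diff = fine_cont_binop[where \<phi> = "(-)"]
  and fine_cont_mult = fine_cont_binop[where \<phi> = "(*)"]

lemma fine_cont_sum:
  "finite A \<Longrightarrow> (\<And>i. i \<in> A \<Longrightarrow> fine_cont (f i)) \<Longrightarrow> fine_cont (\<lambda>z. \<Sum>i\<in>A. f i z)"
proof (induction A rule: finite_induct)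
  case (insert i A) then show ?case by (simp add: fine_cont_add)
qed simp

lemma fine_cont_thick_local:
  assumes "fine_cont f" "x \<notin> \<rat>" "\<eta> > 0" "\<And>y. \<bar>y - x\<bar> < \<eta> \<Longrightarrow> g y = f y"
  shows "thick_at x {y. g y = g x}"
  using assms by - (rule thick_at_mono_near[of x "{y. f y = f x}" \<eta>], auto simp: fine_cont_iff)

text \<open>Every irrational point has a neighbourhood on one side of \<open>q\<close>, where the
  function is \<open>f\<close> or \<open>g\<close>; at \<open>q\<close> itself nothing is to be
  checked.\<close>

lemma fine_cont_rational_cut:
  assumes "fine_cont f" "fine_cont g" "q \<in> \<rat>"
  shows "fine_cont (\<lambda>z. if z \<le> q then f z else g z)"
  unfolding fine_cont_iff
proof (intro allI impI)
  fix x :: real assume x: "x \<notin> \<rat>"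
  then have "x \<noteq> q" using assms(3) by auto
  then consider "x < q" | "x > q" by linarith
  then show "thick_at x {y. (if y \<le> q then f y else g y) = (if x \<le> q then f x else g x)}"
  proof cases
    case 1
    show ?thesis by (rule fine_cont_thick_local[OF assms(1) x, of "q - x"]) (use 1 in auto)
  next
    case 2
    show ?thesis by (rule fine_cont_thick_local[OF assms(2) x, of "x - q"]) (use 2 in auto)
  qed
qed

lemma fine_cont_rational_interval:
  assumes "u \<in> \<rat>" "v \<in> \<rat>"
  shows "fine_cont (\<lambda>z. if u < z \<and> z \<le> v then 1 else 0)"
proof -
  have "(\<lambda>z. if u < z \<and> z \<le> v then 1 else 0) =
      (\<lambda>z. if z \<le> u then 0 else if z \<le> v then 1 else (0::int))" by auto
  moreover have "fine_cont (\<lambda>z. if z \<le> u then 0 else if z \<le> v then 1 else (0::int))"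
    using assms by (intro fine_cont_rational_cut) simp_all
  ultimately show ?thesis by simp
qed

section \<open>Removing small intervals\<close>

text \<open>Removing an open interval leaves at most two closed rational pieces, possibly
  degenerate.\<close>

lemma rational_interval_family_outside_interval:
  assumes "a \<in> \<rat>" "b \<in> \<rat>" "a < b" "r \<in> \<rat>" "s \<in> \<rat>" "r \<le> s"
  shows "\<exists>F. rational_interval_family (- {a<..<b} \<inter> {r..s}) F \<and> total_length F \<ge> (s - r) - (b - a)"
proof -
  consider "r \<le> a" "b \<le> s" | "r \<le> a" "a \<le> s" "s < b" | "a < r" "b \<le> s" "r \<le> b"
    | "s < a \<or> b < r" | "a < r" "s < b"
    by linarith
  then show ?thesis
  proof cases
    case 1
    then show ?thesis using assms
      by (intro exI[of _ "{(r, a), (b, s)}"])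
        (auto simp: rational_interval_family_def total_length_def disjoint_family_on_def)
  next
    case 2
    then show ?thesis using assms
      by (intro exI[of _ "{(r, a)}"])
        (auto simp: rational_interval_family_def total_length_def disjoint_family_on_def)
  next
    case 3
    then show ?thesis using assms
      by (intro exI[of _ "{(b, s)}"])
        (auto simp: rational_interval_family_def total_length_def disjoint_family_on_def)
  next
    case 4
    then show ?thesis using assms
      by (intro exI[of _ "{(r, s)}"])
        (auto simp: rational_interval_family_def total_length_def disjoint_family_on_def)
  next
    case 5
    then show ?thesis using assms
      by (intro exI[of _ "{}"])
        (auto simp: rational_interval_family_def total_length_def disjoint_family_on_def)
  qed
qed

text \<open>Remove the intervals one at a time: when two families are intersected, their losses of
  length at most add up.\<close>

lemma rational_interval_family_outside_intervals:
  assumes "finite I" "\<And>i. i \<in> I \<Longrightarrow> p i \<in> \<rat> \<and> q i \<in> \<rat> \<and> p i < q i" "r \<in> \<rat>" "s \<in> \<rat>" "r \<le> s"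
  shows "\<exists>F. rational_interval_family (- (\<Union>i\<in>I. {p i<..<q i}) \<inter> {r..s}) F \<and>
             total_length F \<ge> (s - r) - (\<Sum>i\<in>I. q i - p i)"
  using assms(1,2)
proof (induction I rule: finite_induct)
  case empty
  have "rational_interval_family (- (\<Union>i\<in>{}. {p i<..<q i}) \<inter> {r..s}) {(r, s)}"
    using assms by (auto simp: rational_interval_family_def disjoint_family_on_def)
  then show ?case by (intro exI[of _ "{(r, s)}"]) (simp add: total_length_def)
next
  case (insert i I)
  obtain F where F: "rational_interval_family (- (\<Union>i\<in>I. {p i<..<q i}) \<inter> {r..s}) F"
    "total_length F \<ge> (s - r) - (\<Sum>i\<in>I. q i - p i)"
    using insert by auto
  obtain F' where F': "rational_interval_family (- {p i<..<q i} \<inter> {r..s}) F'"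
    "total_length F' \<ge> (s - r) - (q i - p i)"
    using rational_interval_family_outside_interval[of "p i" "q i" r s] insert.prems[of i] assms by auto
  obtain H where H: "rational_interval_family (- (\<Union>i\<in>I. {p i<..<q i}) \<inter> - {p i<..<q i} \<inter> {r..s}) H"
    "total_length H \<ge> total_length F + total_length F' - (s - r)"
    using rational_interval_family_Int[OF F(1) F'(1) assms(5)] by blast
  have "rational_interval_family (- (\<Union>i\<in>insert i I. {p i<..<q i}) \<inter> {r..s}) H"
    by (rule rational_interval_family_mono[OF H(1)]) auto
  then show ?case using H(2) F(2) F'(2) insert.hyps by (intro exI[of _ H]) auto
qed

lemma sum_geometric_half_le: "(\<Sum>n\<in>{N..<M}. (1/2 :: real) ^ n) \<le> 2 * (1/2) ^ N"
proof -
  \<comment> \<open>Subtracting the remaining tail makes the bound inductive.\<close>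
  have "(\<Sum>n\<in>{N..<M}. (1/2 :: real) ^ n) \<le> 2 * (1/2) ^ N - (if N \<le> M then 2 * (1/2) ^ M else 0)"
    by (induction M) (auto simp: atLeastLessThanSuc le_Suc_eq)
  also have "\<dots> \<le> 2 * (1/2) ^ N" by simp
  finally show ?thesis .
qed

text \<open>Only finitely many intervals can be removed from \<open>{r..s}\<close> one by one. The
  first \<open>N\<close> miss \<open>{r..s}\<close> if it is short; all from some \<open>M\<close>
  on are swallowed by one tiny interval around \<open>x\<close>; by \<open>far\<close>, those in
  between that meet \<open>{r..s}\<close> have lengths at most \<open>(s - r) / 2 ^ n\<close>, a
  geometric series with small sum.\<close>

lemma thick_at_outside_small_intervals:
  fixes x :: real
  assumes x: "x \<notin> \<rat>"
    and pq: "\<And>n. p n \<in> \<rat> \<and> q n \<in> \<rat> \<and> p n < q n"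
    and far: "\<And>n z. p n < z \<Longrightarrow> z < q n \<Longrightarrow> (q n - p n) * 2 ^ n \<le> \<bar>z - x\<bar>"
    and near: "\<And>\<tau>. \<tau> > 0 \<Longrightarrow> \<exists>M. \<forall>n\<ge>M. \<forall>z. p n < z \<and> z < q n \<longrightarrow> \<bar>z - x\<bar> < \<tau>"
  shows "thick_at x (- (\<Union>n. {p n<..<q n}))"
  unfolding thick_at_def
proof (intro allI impI)
  fix \<epsilon> :: real assume e: "\<epsilon> > 0"
  then obtain N where N: "(1/2 :: real) ^ N < \<epsilon> / 4"
    using real_arch_pow_inv[of "\<epsilon> / 4" "1/2"] by auto
  \<comment> \<open>By \<open>far\<close>, the first \<open>N\<close> intervals keep distance at
    least \<open>\<delta>\<close> from \<open>x\<close>. The inserted 1 covers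
    \<open>N = 0\<close>.\<close>
  define \<delta> where "\<delta> = Min (insert 1 ((\<lambda>n. (q n - p n) * 2 ^ n) ` {..<N}))"
  have \<delta>: "\<delta> > 0" "\<And>n. n < N \<Longrightarrow> \<delta> \<le> (q n - p n) * 2 ^ n"
    using pq by (auto simp: \<delta>_def)
  have "\<exists>F. rational_interval_family (- (\<Union>n. {p n<..<q n}) \<inter> {r..s}) F \<and>
      total_length F \<ge> (1 - \<epsilon>) * (s - r)"
    if rs: "r \<in> \<rat>" "s \<in> \<rat>" "{r..s} \<subseteq> {0..1}" "x \<in> {r..s}" "s - r < \<delta>" for r s
  proof -
    have "x \<noteq> r" "x \<noteq> s" using rs x by auto
    then have xrs: "r < x" "x < s" using rs by auto
    \<comment> \<open>The interval from \<open>u\<close> to \<open>v\<close> around \<open>x\<close>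
      is shorter than \<open>2 * \<tau>\<close>, which is half of the permitted loss.\<close>
    define \<tau> where "\<tau> = \<epsilon> / 4 * (s - r)"
    have \<tau>: "\<tau> > 0" using e xrs by (simp add: \<tau>_def)
    obtain u where u: "u \<in> \<rat>" "x - \<tau> < u" "u < x" using Rats_dense_in_real[of "x - \<tau>" x] \<tau> by auto
    obtain v where v: "v \<in> \<rat>" "x < v" "v < x + \<tau>" using Rats_dense_in_real[of x "x + \<tau>"] \<tau> by auto
    obtain M where M: "\<And>n z. n \<ge> M \<Longrightarrow> p n < z \<Longrightarrow> z < q n \<Longrightarrow> \<bar>z - x\<bar> < min (x - u) (v - x)"
      using near[of "min (x - u) (v - x)"] u v by auto
    define I where "I = {n \<in> {N..<M}. {p n<..<q n} \<inter> {r..s} \<noteq> {}}"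
    have len: "q n - p n \<le> (1/2) ^ n * (s - r)" if "n \<in> I" for n
    proof -
      have "{p n<..<q n} \<inter> {r..s} \<noteq> {}" using that by (simp add: I_def)
      then obtain z where "z \<in> {p n<..<q n}" "z \<in> {r..s}" by blast
      then have z: "p n < z" "z < q n" "z \<in> {r..s}" by auto
      have "(q n - p n) * 2 ^ n \<le> s - r" using far[OF z(1,2)] z(3) rs(4) by auto
      then show ?thesis by (simp add: power_divide pos_le_divide_eq)
    qed
    have "(\<Sum>n\<in>I. q n - p n) \<le> (\<Sum>n\<in>I. (1/2) ^ n * (s - r))" using len by (rule sum_mono)
    also have "\<dots> \<le> (\<Sum>n\<in>{N..<M}. (1/2) ^ n * (s - r))"
      using xrs by (intro sum_mono2) (auto simp: I_def)
    also have "\<dots> \<le> 2 * (1/2) ^ N * (s - r)"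
      unfolding sum_distrib_right[symmetric] using xrs sum_geometric_half_le
      by (intro mult_right_mono) auto
    also have "\<dots> \<le> \<epsilon> / 2 * (s - r)" using N xrs by (intro mult_right_mono) auto
    finally have sum: "(\<Sum>n\<in>I. q n - p n) \<le> \<epsilon> / 2 * (s - r)" .
    obtain F where F: "rational_interval_family (- (\<Union>i\<in>I. {p i<..<q i}) \<inter> {r..s}) F"
      "total_length F \<ge> (s - r) - (\<Sum>i\<in>I. q i - p i)"
      using rational_interval_family_outside_intervals[of I p q r s] pq rs xrs by (auto simp: I_def)
    obtain F' where F': "rational_interval_family (- {u<..<v} \<inter> {r..s}) F'"
      "total_length F' \<ge> (s - r) - (v - u)"
      using rational_interval_family_outside_interval[of u v r s] u v rs xrs by auto
    obtain H where H: "rational_interval_family (- (\<Union>i\<in>I. {p i<..<q i}) \<inter> - {u<..<v} \<inter> {r..s}) H"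
      "total_length H \<ge> total_length F + total_length F' - (s - r)"
      using rational_interval_family_Int[OF F(1) F'(1)] xrs by auto
    have "z \<notin> {p n<..<q n}" if z: "z \<in> {r..s}" "z \<notin> {u<..<v}" "\<And>i. i \<in> I \<Longrightarrow> z \<notin> {p i<..<q i}" for z n
    proof
      assume zn: "z \<in> {p n<..<q n}"
      then have "n < M" using M[of n z] z(2) by force
      moreover have "n \<ge> N"
      proof (rule ccontr)
        assume "\<not> n \<ge> N"
        then have "\<delta> \<le> \<bar>z - x\<bar>" using \<delta>(2)[of n] far[of n z] zn by simp
        then show False using z(1) rs by auto
      qed
      ultimately have "n \<in> I" using zn z(1) by (auto simp: I_def)
      then show False using z(3) zn by blast
    qed
    then have "rational_interval_family (- (\<Union>n. {p n<..<q n}) \<inter> {r..s}) H"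
      by (intro rational_interval_family_mono[OF H(1)]) blast
    moreover have "total_length H \<ge> (1 - \<epsilon>) * (s - r)"
    proof -
      have "v - u \<le> \<epsilon> / 2 * (s - r)" using u v by (simp add: \<tau>_def)
      moreover have "(1 - \<epsilon>) * (s - r) = (s - r) - \<epsilon> / 2 * (s - r) - \<epsilon> / 2 * (s - r)"
        by (simp add: algebra_simps)
      ultimately show ?thesis using H(2) F(2) F'(2) sum by linarith
    qed
    ultimately show ?thesis by blast
  qed
  then show "\<exists>\<delta>>0. \<forall>r s. r \<in> \<rat> \<and> s \<in> \<rat> \<and> {r..s} \<subseteq> {0..1} \<and> x \<in> {r..s} \<and> s - r < \<delta> \<longrightarrow>
     (\<exists>F. rational_interval_family (- (\<Union>n. {p n<..<q n}) \<inter> {r..s}) F \<and>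
        total_length F \<ge> (1 - \<epsilon>) * (s - r))"
    using \<delta>(1) by blast
qed

section \<open>Locally finite sums\<close>

text \<open>The index set depends on \<open>f\<close> and \<open>z\<close> but not on
  \<open>c\<close>, so additivity in \<open>c\<close> is immediate. If it is infinite, the sum is 0
  by convention.\<close>

definition combination :: "(nat \<Rightarrow> real \<Rightarrow> int) \<Rightarrow> (nat \<Rightarrow> int) \<Rightarrow> real \<Rightarrow> int" where
  "combination f c z = (\<Sum>n\<in>{n. f n z \<noteq> 0}. c n * f n z)"

lemma combination_add: "combination f (\<lambda>n. a n + b n) z = combination f a z + combination f b z"
  by (simp add: combination_def distrib_right sum.distrib)

lemma combination_eq_sum:
  assumes "\<And>n. n \<ge> N \<Longrightarrow> f n z = 0"
  shows "combination f c z = (\<Sum>n<N. c n * f n z)"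
  unfolding combination_def
proof (rule sum.mono_neutral_left)
  show "{n. f n z \<noteq> 0} \<subseteq> {..<N}" using assms by (auto simp: not_le[symmetric])
qed auto

text \<open>These conditions put every combination of the \<open>f n\<close>, with arbitrary integer
  coefficients, among the finely continuous functions: local finiteness handles points other than
  \<open>x\<close>, thickness of the common zero set handles \<open>x\<close>.\<close>

locale fine_concentrating_sequence =
  fixes f :: "nat \<Rightarrow> real \<Rightarrow> int" and x :: real
  assumes cont: "fine_cont (f n)"
    and zero: "f n x = 0"
    and locally_finite: "z \<noteq> x \<Longrightarrow> \<exists>\<eta>>0. \<exists>N. \<forall>n\<ge>N. \<forall>y. \<bar>y - z\<bar> < \<eta> \<longrightarrow> f n y = 0"
    and thick: "x \<notin> \<rat> \<Longrightarrow> thick_at x {y. \<forall>n. f n y = 0}"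
begin

lemma eventually_zero: "\<exists>N. \<forall>n\<ge>N. f n z = 0"
proof (cases "z = x")
  case False
  then obtain \<eta> N where "\<eta> > 0" "\<forall>n\<ge>N. \<forall>y. \<bar>y - z\<bar> < \<eta> \<longrightarrow> f n y = 0"
    using locally_finite by blast
  then show ?thesis by (intro exI[of _ N]) simp
qed (simp add: zero)

lemma combination_unit: "combination f (\<lambda>n. if n = i then 1 else 0) = f i"
proof
  fix z
  obtain N where N: "\<forall>n\<ge>N. f n z = 0" using eventually_zero by blast
  then have "combination f (\<lambda>n. if n = i then 1 else 0) z = (\<Sum>n<N. (if n = i then 1 else 0) * f n z)"
    by (intro combination_eq_sum) auto
  also have "\<dots> = (\<Sum>n<N. if n = i then f n z else 0)"
    by (intro sum.cong) auto
  also have "\<dots> = f i z" using N by simp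
  finally show "combination f (\<lambda>n. if n = i then 1 else 0) z = f i z" .
qed

text \<open>At \<open>x\<close> the combination is 0, as it is on the thick common zero set; near
  any other point it is a finite sum.\<close>

lemma fine_cont_combination: "fine_cont (combination f c)"
  unfolding fine_cont_iff
proof (intro allI impI)
  fix z :: real assume z: "z \<notin> \<rat>"
  show "thick_at z {y. combination f c y = combination f c z}"
  proof (cases "z = x")
    case True
    then show ?thesis using thick z zero
      by (auto simp: combination_def intro: thick_at_mono)
  next
    case False
    then obtain \<eta> N where *: "\<eta> > 0" "\<forall>n\<ge>N. \<forall>y. \<bar>y - z\<bar> < \<eta> \<longrightarrow> f n y = 0"
      using locally_finite by blast
    have "fine_cont (\<lambda>y. \<Sum>n<N. c n * f n y)"
      by (intro fine_cont_sum fine_cont_mult cont) simp_all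
    then show ?thesis using z *(1)
      by (rule fine_cont_thick_local) (use * in \<open>auto intro!: combination_eq_sum\<close>)
  qed
qed

end

section \<open>Additive functionals on the finely continuous functions\<close>

text \<open>Total functions on the reals replace the extensional ones of \<open>fine_group\<close>,
  so that cutting and multiplying need no restriction. The intended \<open>\<Phi>\<close> is a
  homomorphism on \<open>fine_group\<close> preceded by restriction to the unit interval.\<close>

locale fine_functional =
  fixes \<Phi> :: "(real \<Rightarrow> int) \<Rightarrow> int"
  assumes add: "fine_cont f \<Longrightarrow> fine_cont g \<Longrightarrow> \<Phi> (\<lambda>z. f z + g z) = \<Phi> f + \<Phi> g"
begin

lemma scale:
  assumes "fine_cont g"
  shows "\<Phi> (\<lambda>z. k * g z) = k * \<Phi> g"
proof -
  have "\<Phi> (\<lambda>z. (a + b) * g z) = \<Phi> (\<lambda>z. a * g z) + \<Phi> (\<lambda>z. b * g z)" for a b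
    unfolding distrib_right using assms by (intro add fine_cont_mult) simp_all
  then show ?thesis using additive_int_eq_mult[of "\<lambda>k. \<Phi> (\<lambda>z. k * g z)" k] by simp
qed

text \<open>Specker's theorem for the coefficient functional
  \<open>\<lambda>c. \<Phi> (combination f c)\<close>.\<close>

lemma eventually_zero_on_tails:
  assumes "fine_concentrating_sequence f x"
  shows "\<exists>N. \<forall>c. (\<forall>n<N. c n = 0) \<longrightarrow> \<Phi> (combination f c) = 0"
proof -
  interpret fine_concentrating_sequence f x by fact
  have "combination f (\<lambda>n. a n + b n) = (\<lambda>z. combination f a z + combination f b z)" for a b
    by (rule ext) (rule combination_add)
  then interpret additive_on_sequences "\<lambda>c. \<Phi> (combination f c)"
    by unfold_locales (simp add: add fine_cont_combination)
  show ?thesis by (rule zero_on_tails)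
qed

section \<open>Local representations by evaluations and their concatenation\<close>

text \<open>
  The margin \<open>\<eta>\<close> makes this property compatible with concatenation at an irrational point, since
  functions can be cut only at rational points.
\<close>

definition represented_near :: "real set \<Rightarrow> real \<Rightarrow> real \<Rightarrow> bool" where
  "represented_near T a b \<longleftrightarrow> (\<exists>\<eta>>0. \<exists>A c. finite A \<and> A \<subseteq> T \<and>
     (\<forall>g. fine_cont g \<and> (\<forall>z. g z \<noteq> 0 \<longrightarrow> a - \<eta> < z \<and> z < b + \<eta>) \<longrightarrow>
        \<Phi> g = (\<Sum>x\<in>A. c x * g x)))"

lemma represented_nearE:
  assumes "represented_near T a b"
  obtains \<eta> A c where "\<eta> > 0" "finite A" "A \<subseteq> T"
    "\<And>g. fine_cont g \<Longrightarrow> (\<And>z. g z \<noteq> 0 \<Longrightarrow> a - \<eta> < z \<and> z < b + \<eta>) \<Longrightarrow>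
      \<Phi> g = (\<Sum>x\<in>A. c x * g x)"
  using assms unfolding represented_near_def
proof (elim exE conjE)
  fix \<eta> A c
  assume *: "\<eta> > 0" "finite A" "A \<subseteq> T"
    "\<forall>g. fine_cont g \<and> (\<forall>z. g z \<noteq> 0 \<longrightarrow> a - \<eta> < z \<and> z < b + \<eta>) \<longrightarrow>
       \<Phi> g = (\<Sum>x\<in>A. c x * g x)"
  show thesis by (rule that[OF *(1-3)]) (use *(4) in simp)
qed

lemma represented_near_mono:
  assumes "represented_near S a b" "S \<subseteq> T"
  shows "represented_near T a b"
  using assms unfolding represented_near_def
proof (elim exE conjE)
  fix \<eta> :: real and A c
  assume "\<eta> > 0" "finite A" "A \<subseteq> S"
    "\<forall>g. fine_cont g \<and> (\<forall>z. g z \<noteq> 0 \<longrightarrow> a - \<eta> < z \<and> z < b + \<eta>) \<longrightarrow>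
       \<Phi> g = (\<Sum>x\<in>A. c x * g x)"
  with assms(2) show "\<exists>\<eta>>0. \<exists>A c. finite A \<and> A \<subseteq> T \<and>
      (\<forall>g. fine_cont g \<and> (\<forall>z. g z \<noteq> 0 \<longrightarrow> a - \<eta> < z \<and> z < b + \<eta>) \<longrightarrow>
         \<Phi> g = (\<Sum>x\<in>A. c x * g x))"
    by (intro exI conjI) auto
qed

text \<open>Treating vanishing of \<open>\<Phi>\<close> as representation by no points lets one
  compactness argument serve both vanishing and representation.\<close>

lemma represented_near_empty_iff:
  "represented_near {} a b \<longleftrightarrow>
     (\<exists>\<eta>>0. \<forall>g. fine_cont g \<and> (\<forall>z. g z \<noteq> 0 \<longrightarrow> a - \<eta> < z \<and> z < b + \<eta>) \<longrightarrow> \<Phi> g = 0)"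
  by (auto simp: represented_near_def)

text \<open>Cut at a rational \<open>q\<close> within both margins of \<open>b\<close>, and apply
  one representation to each half.\<close>

lemma represented_near_trans:
  assumes "represented_near T a b" "represented_near T b c"
  shows "represented_near T a c"
proof -
  obtain \<eta>1 A1 c1 where 1: "\<eta>1 > 0" "finite A1" "A1 \<subseteq> T"
    "\<And>g. fine_cont g \<Longrightarrow> (\<And>z. g z \<noteq> 0 \<Longrightarrow> a - \<eta>1 < z \<and> z < b + \<eta>1) \<Longrightarrow>
      \<Phi> g = (\<Sum>x\<in>A1. c1 x * g x)"
    using represented_nearE[OF assms(1)] by blast
  obtain \<eta>2 A2 c2 where 2: "\<eta>2 > 0" "finite A2" "A2 \<subseteq> T"
    "\<And>g. fine_cont g \<Longrightarrow> (\<And>z. g z \<noteq> 0 \<Longrightarrow> b - \<eta>2 < z \<and> z < c + \<eta>2) \<Longrightarrow>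
      \<Phi> g = (\<Sum>x\<in>A2. c2 x * g x)"
    using represented_nearE[OF assms(2)] by blast
  define \<eta> where "\<eta> = min \<eta>1 \<eta>2"
  have \<eta>: "\<eta> > 0" "\<eta> \<le> \<eta>1" "\<eta> \<le> \<eta>2" using 1 2 by (auto simp: \<eta>_def)
  obtain q where q: "q \<in> \<rat>" "b - \<eta> < q" "q < b + \<eta>"
    using Rats_dense_in_real[of "b - \<eta>" "b + \<eta>"] \<eta> by auto
  \<comment> \<open>The left coefficients count at points up to \<open>q\<close>, the right ones
    beyond it, each extended by 0 to \<open>A1 \<union> A2\<close>.\<close>
  define e where "e x = (if x \<in> A1 \<and> x \<le> q then c1 x else 0) + (if x \<in> A2 \<and> \<not> x \<le> q then c2 x else 0)" for x
  have "\<Phi> g = (\<Sum>x\<in>A1 \<union> A2. e x * g x)"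
    if g: "fine_cont g" "\<And>z. g z \<noteq> 0 \<Longrightarrow> a - \<eta> < z \<and> z < c + \<eta>" for g
  proof -
    define g1 where "g1 z = (if z \<le> q then g z else 0)" for z
    define g2 where "g2 z = (if z \<le> q then 0 else g z)" for z
    have cont: "fine_cont g1" "fine_cont g2"
      unfolding g1_def g2_def using g(1) q(1) by (auto intro!: fine_cont_rational_cut)
    have "g = (\<lambda>z. g1 z + g2 z)" by (auto simp: g1_def g2_def)
    then have "\<Phi> g = \<Phi> g1 + \<Phi> g2" using add[OF cont] by simp
    also have "\<Phi> g1 = (\<Sum>x\<in>A1. c1 x * g1 x)"
    proof (rule 1(4)[OF cont(1)])
      fix z assume "g1 z \<noteq> 0"
      then show "a - \<eta>1 < z \<and> z < b + \<eta>1"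
        using g(2)[of z] q \<eta> by (auto simp: g1_def split: if_splits)
    qed
    also have "\<dots> = (\<Sum>x\<in>A1 \<union> A2. (if x \<in> A1 \<and> x \<le> q then c1 x else 0) * g x)"
      using 1(2) 2(2) by (intro sum.mono_neutral_cong_left) (auto simp: g1_def)
    also have "\<Phi> g2 = (\<Sum>x\<in>A2. c2 x * g2 x)"
    proof (rule 2(4)[OF cont(2)])
      fix z assume "g2 z \<noteq> 0"
      then show "b - \<eta>2 < z \<and> z < c + \<eta>2"
        using g(2)[of z] q \<eta> by (auto simp: g2_def split: if_splits)
    qed
    also have "\<dots> = (\<Sum>x\<in>A1 \<union> A2. (if x \<in> A2 \<and> \<not> x \<le> q then c2 x else 0) * g x)"
      using 1(2) 2(2) by (intro sum.mono_neutral_cong_left) (auto simp: g2_def)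
    finally show ?thesis by (simp add: e_def distrib_right sum.distrib)
  qed
  then show ?thesis unfolding represented_near_def using \<eta>(1) 1(2,3) 2(2,3)
    by (intro exI[of _ \<eta>] conjI exI[of _ "A1 \<union> A2"] exI[of _ e]) auto
qed

text \<open>Compactness in the form of Bolzano's principle: the relation is transitive and holds for
  all short intervals around each point.\<close>

lemma represented_near_interval:
  assumes "a \<le> b" and loc: "\<And>x. a \<le> x \<Longrightarrow> x \<le> b \<Longrightarrow> represented_near T x x"
  shows "represented_near T a b"
  using \<open>a \<le> b\<close>
proof (induction rule: Bolzano)
  case (trans a b c) then show ?case by (blast intro: represented_near_trans)
next
  case (local x)
  then obtain \<eta> A k where *: "\<eta> > 0" "finite A" "A \<subseteq> T"
    "\<And>g. fine_cont g \<Longrightarrow> (\<And>z. g z \<noteq> 0 \<Longrightarrow> x - \<eta> < z \<and> z < x + \<eta>) \<Longrightarrow>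
      \<Phi> g = (\<Sum>x\<in>A. k x * g x)"
    using represented_nearE[OF loc[OF local]] by blast
  \<comment> \<open>Length below \<open>\<eta> / 2\<close> and margin \<open>\<eta> / 2\<close>
    together stay within the margin \<open>\<eta>\<close> at \<open>x\<close>.\<close>
  have "represented_near T a b" if ab: "a \<le> x" "x \<le> b" "b - a < \<eta> / 2" for a b
    unfolding represented_near_def
  proof (intro exI conjI allI impI)
    fix g assume g: "fine_cont g \<and> (\<forall>z. g z \<noteq> 0 \<longrightarrow> a - \<eta> / 2 < z \<and> z < b + \<eta> / 2)"
    show "\<Phi> g = (\<Sum>x\<in>A. k x * g x)"
    proof (rule *(4))
      fix z assume "g z \<noteq> 0"
      then have "a - \<eta> / 2 < z \<and> z < b + \<eta> / 2" using g by blast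
      then show "x - \<eta> < z \<and> z < x + \<eta>" using ab by auto
    qed (use g in blast)
  qed (use * in auto)
  then show ?case using *(1) by (intro exI[of _ "\<eta> / 2"]) auto
qed

section \<open>Local structure of a functional at a point\<close>

text \<open>
  Functions supported in sufficiently small neighbourhoods of points converging to \<open>x\<close> can be summed
  with arbitrary coefficients, so \<open>\<Phi>\<close> vanishes on almost all of them.
\<close>

lemma vanishing_points_punctured_neighbourhood:
  "\<exists>\<eta>>0. \<forall>y. y \<noteq> x \<and> \<bar>y - x\<bar> < \<eta> \<longrightarrow> represented_near {} y y"
proof (rule ccontr)
  assume "\<not> ?thesis"
  then have "\<exists>y. y \<noteq> x \<and> \<bar>y - x\<bar> < (1/2) ^ n \<and> \<not> represented_near {} y y" for n :: nat
    by (meson half_gt_zero_iff zero_less_one zero_less_power)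
  then obtain y where y: "\<And>n. y n \<noteq> x" "\<And>n. \<bar>y n - x\<bar> < (1/2) ^ n" "\<And>n. \<not> represented_near {} (y n) (y n)"
    by metis
  \<comment> \<open>The 4 keeps the supports away from \<open>x\<close>; the power of 2 makes them
    short relative to their distance from \<open>x\<close>, as
    \<open>thick_at_outside_small_intervals\<close> demands.\<close>
  define w where "w n = \<bar>y n - x\<bar> / (4 * 2 ^ n)" for n
  have w_pos: "w n > 0" for n using y(1)[of n] by (simp add: w_def)
  have w_scaled: "w n * 2 ^ n = \<bar>y n - x\<bar> / 4" for n by (simp add: w_def)
  have w_le: "w n \<le> \<bar>y n - x\<bar> / 4" for n
    unfolding w_def by (intro divide_left_mono) auto
  have "\<exists>p. p \<in> \<rat> \<and> y n - w n < p \<and> p < y n" for n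
    using Rats_dense_in_real[of "y n - w n" "y n"] w_pos[of n] by auto
  then obtain p where p: "\<And>n. p n \<in> \<rat> \<and> y n - w n < p n \<and> p n < y n" by metis
  have "\<exists>q. q \<in> \<rat> \<and> y n < q \<and> q < y n + w n" for n
    using Rats_dense_in_real[of "y n" "y n + w n"] w_pos[of n] by auto
  then obtain q where q: "\<And>n. q n \<in> \<rat> \<and> y n < q n \<and> q n < y n + w n" by metis
  \<comment> \<open>Vanishing at \<open>y n\<close> fails for every margin, hence for one that fits
    between \<open>p n\<close> and \<open>q n\<close>.\<close>
  have "\<exists>g. fine_cont g \<and> (\<forall>z. g z \<noteq> 0 \<longrightarrow> p n < z \<and> z < q n) \<and> \<Phi> g \<noteq> 0" for n
  proof -
    define m where "m = min (y n - p n) (q n - y n)"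
    have "m > 0" using p[of n] q[of n] by (simp add: m_def)
    then obtain g where g: "fine_cont g" "\<And>z. g z \<noteq> 0 \<Longrightarrow> y n - m < z \<and> z < y n + m" "\<Phi> g \<noteq> 0"
      using y(3)[of n] unfolding represented_near_empty_iff by blast
    have "p n < z \<and> z < q n" if "g z \<noteq> 0" for z
      using g(2)[OF that] by (auto simp: m_def)
    then show ?thesis using g by blast
  qed
  then obtain f where f: "\<And>n. fine_cont (f n)" "\<And>n z. f n z \<noteq> 0 \<Longrightarrow> p n < z \<and> z < q n" "\<And>n. \<Phi> (f n) \<noteq> 0"
    by metis
  have upper: "\<bar>z - x\<bar> < 2 * (1/2) ^ n" and lower: "3/4 * \<bar>y n - x\<bar> \<le> \<bar>z - x\<bar>"
    if "p n < z" "z < q n" for n z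
  proof -
    have "\<bar>z - y n\<bar> < w n" using that p[of n] q[of n] by (simp add: abs_less_iff)
    then have "\<bar>z - y n\<bar> \<le> \<bar>y n - x\<bar> / 4" using w_le[of n] by linarith
    moreover have "\<bar>z - x\<bar> \<le> \<bar>z - y n\<bar> + \<bar>y n - x\<bar>" "\<bar>y n - x\<bar> \<le> \<bar>z - y n\<bar> + \<bar>z - x\<bar>"
      by linarith+
    ultimately show "\<bar>z - x\<bar> < 2 * (1/2) ^ n" "3/4 * \<bar>y n - x\<bar> \<le> \<bar>z - x\<bar>"
      using y(2)[of n] by simp_all
  qed
  have near: "\<exists>M. \<forall>n\<ge>M. \<forall>z. p n < z \<and> z < q n \<longrightarrow> \<bar>z - x\<bar> < \<tau>" if \<tau>: "\<tau> > 0" for \<tau>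
  proof -
    obtain M where M: "(1/2 :: real) ^ M < \<tau> / 2"
      using real_arch_pow_inv[of "\<tau> / 2" "1/2"] \<tau> by auto
    have "\<bar>z - x\<bar> < \<tau>" if "n \<ge> M" "p n < z" "z < q n" for n z
    proof -
      have "(1/2 :: real) ^ n \<le> (1/2) ^ M" using that(1) by (intro power_decreasing) auto
      then show ?thesis using upper[OF that(2,3)] M by linarith
    qed
    then show ?thesis by blast
  qed
  have "fine_concentrating_sequence f x"
  proof
    show "fine_cont (f n)" for n by fact
    show "f n x = 0" for n
    proof (rule ccontr)
      assume "f n x \<noteq> 0"
      then have "3/4 * \<bar>y n - x\<bar> \<le> \<bar>x - x\<bar>" by (intro lower) (use f(2) in auto)
      then show False using y(1)[of n] by simp
    qed
    fix z assume "z \<noteq> x"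
    then obtain M where M: "\<And>n z'. n \<ge> M \<Longrightarrow> p n < z' \<Longrightarrow> z' < q n \<Longrightarrow> \<bar>z' - x\<bar> < \<bar>z - x\<bar> / 2"
      using near[of "\<bar>z - x\<bar> / 2"] by auto
    have "f n y = 0" if "n \<ge> M" "\<bar>y - z\<bar> < \<bar>z - x\<bar> / 2" for n y
    proof (rule ccontr)
      assume "f n y \<noteq> 0"
      then have "\<bar>y - x\<bar> < \<bar>z - x\<bar> / 2" using M[OF that(1)] f(2) by blast
      moreover have "\<bar>z - x\<bar> \<le> \<bar>y - z\<bar> + \<bar>y - x\<bar>" by linarith
      ultimately show False using that(2) by simp
    qed
    then show "\<exists>\<eta>>0. \<exists>N. \<forall>n\<ge>N. \<forall>y. \<bar>y - z\<bar> < \<eta> \<longrightarrow> f n y = 0"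
      using \<open>z \<noteq> x\<close> by (intro exI[of _ "\<bar>z - x\<bar> / 2"]) auto
  next
    assume x: "x \<notin> \<rat>"
    have "thick_at x (- (\<Union>n. {p n<..<q n}))"
    proof (rule thick_at_outside_small_intervals[OF x _ _ near])
      show "p n \<in> \<rat> \<and> q n \<in> \<rat> \<and> p n < q n" for n using p[of n] q[of n] by auto
      fix n z assume z: "p n < z" "z < q n"
      have "(q n - p n) * 2 ^ n \<le> 2 * w n * 2 ^ n" using p[of n] q[of n] by (intro mult_right_mono) auto
      also have "\<dots> = \<bar>y n - x\<bar> / 2" using w_scaled[of n] by simp
      also have "\<dots> \<le> \<bar>z - x\<bar>" using lower[OF z] by linarith
      finally show "(q n - p n) * 2 ^ n \<le> \<bar>z - x\<bar>" .
    qed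
    then show "thick_at x {y. \<forall>n. f n y = 0}" by (rule thick_at_mono) (use f(2) in fastforce)
  qed
  then interpret fine_concentrating_sequence f x .
  obtain N where "\<And>c. (\<forall>n<N. c n = 0) \<Longrightarrow> \<Phi> (combination f c) = 0"
    using eventually_zero_on_tails fine_concentrating_sequence_axioms by blast
  \<comment> \<open>The unit sequence at \<open>N\<close> vanishes below \<open>N\<close>, and its
    combination is \<open>f N\<close>.\<close>
  from this[of "\<lambda>n. if n = N then 1 else 0"] have "\<Phi> (f N) = 0" by (simp add: combination_unit)
  then show False using f(3) by blast
qed

text \<open>Subtracting \<open>g x\<close> times a clopen indicator around \<open>x\<close> leaves a
  function that vanishes at \<open>x\<close>. Such functions, supported near \<open>x\<close>, are
  killed, so the coefficient is the value of \<open>\<Phi>\<close> on the indicator.\<close>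

lemma represented_near_point: "represented_near {x} x x"
proof -
  obtain \<eta> where \<eta>: "\<eta> > 0" "\<And>y. y \<noteq> x \<Longrightarrow> \<bar>y - x\<bar> < \<eta> \<Longrightarrow> represented_near {} y y"
    using vanishing_points_punctured_neighbourhood[of x] by blast
  have interval: "\<Phi> h = 0"
    if h: "fine_cont h" "\<And>z. h z \<noteq> 0 \<Longrightarrow> a \<le> z \<and> z \<le> b"
      and ab: "a \<le> b" "x - \<eta> < a" "b < x + \<eta>" "x < a \<or> b < x" for h a b
  proof -
    have "represented_near {} y y" if "a \<le> y" "y \<le> b" for y
      using ab that by (intro \<eta>(2)) auto
    then have "represented_near {} a b" by (rule represented_near_interval[OF ab(1)])
    then obtain \<epsilon> where "\<epsilon> > 0"
      "\<And>g. fine_cont g \<Longrightarrow> (\<And>z. g z \<noteq> 0 \<Longrightarrow> a - \<epsilon> < z \<and> z < b + \<epsilon>) \<Longrightarrow> \<Phi> g = 0"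
      unfolding represented_near_empty_iff by blast
    moreover have "a - \<epsilon> < z \<and> z < b + \<epsilon>" if "h z \<noteq> 0" for z
      using h(2)[OF that] \<open>\<epsilon> > 0\<close> by auto
    ultimately show ?thesis using h(1) by blast
  qed
  \<comment> \<open>The support avoids a neighbourhood of \<open>x\<close>, so a rational cut just
    left of \<open>x\<close> separates its two sides, and \<open>interval\<close> applies to
    each.\<close>
  have ring: "\<Phi> h = 0"
    if h: "fine_cont h" "\<And>z. h z \<noteq> 0 \<Longrightarrow> \<kappa> \<le> \<bar>z - x\<bar> \<and> \<bar>z - x\<bar> \<le> \<eta> / 2" and "\<kappa> > 0" "\<kappa> \<le> \<eta> / 2" for h \<kappa>
  proof -
    obtain q where q: "q \<in> \<rat>" "x - \<kappa> < q" "q < x" using Rats_dense_in_real[of "x - \<kappa>" x] \<open>\<kappa> > 0\<close> by auto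
    define h1 where "h1 z = (if z \<le> q then h z else 0)" for z
    define h2 where "h2 z = (if z \<le> q then 0 else h z)" for z
    have cont: "fine_cont h1" "fine_cont h2"
      unfolding h1_def h2_def using h(1) q(1) by (auto intro!: fine_cont_rational_cut)
    have "\<Phi> h1 = 0"
    proof (rule interval[OF cont(1)])
      fix z assume "h1 z \<noteq> 0"
      then show "x - \<eta> / 2 \<le> z \<and> z \<le> x - \<kappa>"
        using h(2)[of z] q by (auto simp: h1_def split: if_splits)
    qed (use that \<eta> in auto)
    moreover have "\<Phi> h2 = 0"
    proof (rule interval[OF cont(2)])
      fix z assume "h2 z \<noteq> 0"
      then show "x + \<kappa> \<le> z \<and> z \<le> x + \<eta> / 2"
        using h(2)[of z] q by (auto simp: h2_def split: if_splits)
    qed (use that \<eta> in auto)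
    moreover have "h = (\<lambda>z. h1 z + h2 z)" by (auto simp: h1_def h2_def)
    ultimately show ?thesis using add[OF cont] by simp
  qed
  have "\<exists>u. u \<in> \<rat> \<and> x - \<eta> / 2 * (1/2) ^ n < u \<and> u < x" for n
    using Rats_dense_in_real[of "x - \<eta> / 2 * (1/2) ^ n" x] \<eta>(1) by auto
  then obtain u where u: "\<And>n. u n \<in> \<rat> \<and> x - \<eta> / 2 * (1/2) ^ n < u n \<and> u n < x" by metis
  have "\<exists>v. v \<in> \<rat> \<and> x < v \<and> v < x + \<eta> / 2 * (1/2) ^ n" for n
    using Rats_dense_in_real[of x "x + \<eta> / 2 * (1/2) ^ n"] \<eta>(1) by auto
  then obtain v where v: "\<And>n. v n \<in> \<rat> \<and> x < v n \<and> v n < x + \<eta> / 2 * (1/2) ^ n" by metis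
  \<comment> \<open>Clopen indicators of intervals shrinking to \<open>x\<close>;
    \<open>\<kappa> n\<close> is a radius within which \<open>\<xi> n\<close> equals 1.\<close>
  define \<xi> :: "nat \<Rightarrow> real \<Rightarrow> int" where "\<xi> n z = (if u n < z \<and> z \<le> v n then 1 else 0)" for n z
  define \<kappa> where "\<kappa> n = min (x - u n) (v n - x)" for n
  have \<xi>_cont: "fine_cont (\<xi> n)" for n
    unfolding \<xi>_def using u v by (intro fine_cont_rational_interval) auto
  have \<xi>_inner: "\<xi> n z = 1" if "\<bar>z - x\<bar> < \<kappa> n" for n z
    using that by (auto simp: \<xi>_def \<kappa>_def)
  have \<xi>_outer: "\<bar>z - x\<bar> < \<eta> / 2 * (1/2) ^ n" if "\<xi> n z \<noteq> 0" for n z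
  proof -
    have "u n < z" "z \<le> v n" using that by (auto simp: \<xi>_def split: if_splits)
    then show ?thesis using u[of n] v[of n] unfolding abs_less_iff by linarith
  qed
  have \<kappa>: "\<kappa> n > 0" "\<kappa> n \<le> \<eta> / 2" for n
  proof -
    show "\<kappa> n > 0" using u[of n] v[of n] by (auto simp: \<kappa>_def)
    have "\<eta> / 2 * (1/2) ^ n \<le> \<eta> / 2 * 1" using \<eta>(1) by (intro mult_left_mono power_le_one) auto
    moreover have "\<kappa> n \<le> x - u n" by (simp add: \<kappa>_def)
    ultimately show "\<kappa> n \<le> \<eta> / 2" using u[of n] by linarith
  qed
  have punctured: "\<Phi> g = 0"
    if g: "fine_cont g" "g x = 0" "\<And>z. g z \<noteq> 0 \<Longrightarrow> \<bar>z - x\<bar> < \<eta> / 2" for g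
  proof -
    \<comment> \<open>The shells of \<open>g\<close>: the differences telescope, whether or not the
      intervals are nested. Each shell vanishes where \<open>g\<close> does, so continuity of
      \<open>g\<close> at \<open>x\<close> makes the common zero set thick.\<close>
    define f where "f n z = g z * (\<xi> n z - \<xi> (Suc n) z)" for n z
    have "fine_concentrating_sequence f x"
    proof
      show "fine_cont (f n)" for n
        unfolding f_def by (intro fine_cont_mult fine_cont_diff g(1) \<xi>_cont)
      show "f n x = 0" for n by (simp add: f_def g(2))
      fix z assume z: "z \<noteq> x"
      have "\<exists>N. (1/2 :: real) ^ N < \<bar>z - x\<bar> / \<eta>"
        using real_arch_pow_inv[of "\<bar>z - x\<bar> / \<eta>" "1/2"] z \<eta>(1) by auto
      then obtain N where N: "(1/2 :: real) ^ N < \<bar>z - x\<bar> / \<eta>" by blast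
      have *: "\<xi> n y = 0" if "n \<ge> N" "\<bar>y - z\<bar> < \<bar>z - x\<bar> / 2" for n y
      proof (rule ccontr)
        assume "\<xi> n y \<noteq> 0"
        then have "\<bar>y - x\<bar> < \<eta> / 2 * (1/2) ^ n" by (rule \<xi>_outer)
        also have "\<dots> \<le> \<eta> / 2 * (1/2) ^ N"
          using that(1) \<eta>(1) by (intro mult_left_mono power_decreasing) auto
        also have "\<dots> \<le> \<eta> / 2 * (\<bar>z - x\<bar> / \<eta>)" using N \<eta>(1) by (intro mult_left_mono) auto
        also have "\<dots> = \<bar>z - x\<bar> / 2" using \<eta>(1) by simp
        finally have "\<bar>y - x\<bar> < \<bar>z - x\<bar> / 2" .
        moreover have "\<bar>z - x\<bar> \<le> \<bar>y - z\<bar> + \<bar>y - x\<bar>" by linarith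
        ultimately show False using that(2) by simp
      qed
      have "\<forall>n\<ge>N. \<forall>y. \<bar>y - z\<bar> < \<bar>z - x\<bar> / 2 \<longrightarrow> f n y = 0" by (simp add: f_def *)
      then show "\<exists>\<eta>>0. \<exists>N. \<forall>n\<ge>N. \<forall>y. \<bar>y - z\<bar> < \<eta> \<longrightarrow> f n y = 0"
        using z by (intro exI[of _ "\<bar>z - x\<bar> / 2"]) auto
    next
      assume "x \<notin> \<rat>"
      then have "thick_at x {y. g y = g x}" using g(1) unfolding fine_cont_iff by blast
      then show "thick_at x {y. \<forall>n. f n y = 0}" by (rule thick_at_mono) (auto simp: f_def g(2))
    qed
    then interpret fine_concentrating_sequence f x .
    obtain N where N: "\<And>c. (\<forall>n<N. c n = 0) \<Longrightarrow> \<Phi> (combination f c) = 0"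
      using eventually_zero_on_tails fine_concentrating_sequence_axioms by blast
    \<comment> \<open>With coefficient 1 from \<open>N\<close> on, the shells add up to the part of
      \<open>g\<close> inside the \<open>N\<close>-th interval.\<close>
    have tail: "combination f (\<lambda>n. if n < N then 0 else 1) = (\<lambda>z. g z * \<xi> N z)"
    proof
      fix z
      show "combination f (\<lambda>n. if n < N then 0 else 1) z = g z * \<xi> N z"
      proof (cases "z = x")
        case True
        then show ?thesis by (simp add: combination_def zero g(2))
      next
        case False
        obtain K where K: "\<forall>n\<ge>K. f n z = 0" using eventually_zero by blast
        obtain L where L: "(1/2 :: real) ^ L < \<bar>z - x\<bar> / \<eta>"
          using real_arch_pow_inv[of "\<bar>z - x\<bar> / \<eta>" "1/2"] False \<eta>(1) by auto
        \<comment> \<open>From \<open>K\<close> on all shells vanish at \<open>z\<close>, and from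
          \<open>L\<close> on the intervals exclude \<open>z\<close>.\<close>
        define M where "M = max N (max K L)"
        have "\<xi> M z = 0"
        proof (rule ccontr)
          assume "\<xi> M z \<noteq> 0"
          then have "\<bar>z - x\<bar> < \<eta> / 2 * (1/2) ^ M" by (rule \<xi>_outer)
          also have "\<dots> \<le> \<eta> / 2 * (1/2) ^ L"
            using \<eta>(1) by (intro mult_left_mono power_decreasing) (auto simp: M_def)
          also have "\<dots> \<le> \<eta> / 2 * (\<bar>z - x\<bar> / \<eta>)" using L \<eta>(1) by (intro mult_left_mono) auto
          finally show False using \<eta>(1) by simp
        qed
        have "combination f (\<lambda>n. if n < N then 0 else 1) z = (\<Sum>n<M. (if n < N then 0 else 1) * f n z)"
          using K by (intro combination_eq_sum) (auto simp: M_def)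
        also have "\<dots> = (\<Sum>n\<in>{N..<M}. f n z)"
          by (intro sum.mono_neutral_cong_right) auto
        also have "\<dots> = - g z * (\<Sum>n\<in>{N..<M}. \<xi> (Suc n) z - \<xi> n z)"
          unfolding sum_distrib_left f_def by (intro sum.cong) (auto simp: algebra_simps)
        also have "\<dots> = - g z * (\<xi> M z - \<xi> N z)"
          by (subst sum_Suc_diff') (auto simp: M_def)
        finally show ?thesis using \<open>\<xi> M z = 0\<close> by simp
      qed
    qed
    have "\<Phi> (\<lambda>z. g z * \<xi> N z) = 0" using N[of "\<lambda>n. if n < N then 0 else 1"] by (simp add: tail)
    \<comment> \<open>The rest of \<open>g\<close> is supported at distance at least
      \<open>\<kappa> N\<close> from \<open>x\<close>.\<close>
    moreover have "\<Phi> (\<lambda>z. g z * (1 - \<xi> N z)) = 0"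
    proof (rule ring[OF _ _ \<kappa>])
      show "fine_cont (\<lambda>z. g z * (1 - \<xi> N z))"
        by (intro fine_cont_mult fine_cont_diff g(1) \<xi>_cont fine_cont_const)
      fix z assume "g z * (1 - \<xi> N z) \<noteq> 0"
      then have "g z \<noteq> 0" "\<xi> N z \<noteq> 1" by auto
      then show "\<kappa> N \<le> \<bar>z - x\<bar> \<and> \<bar>z - x\<bar> \<le> \<eta> / 2"
        using g(3)[of z] \<xi>_inner[of z N] by linarith
    qed
    moreover have "\<Phi> (\<lambda>z. g z * \<xi> N z + g z * (1 - \<xi> N z)) =
        \<Phi> (\<lambda>z. g z * \<xi> N z) + \<Phi> (\<lambda>z. g z * (1 - \<xi> N z))"
      by (intro add fine_cont_mult fine_cont_diff g(1) \<xi>_cont fine_cont_const)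
    moreover have "(\<lambda>z. g z * \<xi> N z + g z * (1 - \<xi> N z)) = g" by (auto simp: algebra_simps)
    ultimately show ?thesis by simp
  qed
  have "\<Phi> g = (\<Sum>y\<in>{x}. \<Phi> (\<xi> 0) * g y)"
    if g: "fine_cont g" "\<And>z. g z \<noteq> 0 \<Longrightarrow> x - \<eta> / 2 < z \<and> z < x + \<eta> / 2" for g
  proof -
    have "\<Phi> (\<lambda>z. g z - g x * \<xi> 0 z) = 0"
    proof (rule punctured)
      show "fine_cont (\<lambda>z. g z - g x * \<xi> 0 z)"
        by (intro fine_cont_mult fine_cont_diff g(1) \<xi>_cont fine_cont_const)
      show "g x - g x * \<xi> 0 x = 0" using \<xi>_inner[of x 0] \<kappa>(1)[of 0] by simp
      fix z assume "g z - g x * \<xi> 0 z \<noteq> 0"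
      then have "g z \<noteq> 0 \<or> \<xi> 0 z \<noteq> 0" by auto
      then show "\<bar>z - x\<bar> < \<eta> / 2"
      proof
        assume "g z \<noteq> 0"
        then show ?thesis using g(2)[of z] unfolding abs_less_iff by linarith
      qed (use \<xi>_outer[of 0 z] in simp)
    qed
    moreover have "\<Phi> (\<lambda>z. (g z - g x * \<xi> 0 z) + g x * \<xi> 0 z) =
        \<Phi> (\<lambda>z. g z - g x * \<xi> 0 z) + \<Phi> (\<lambda>z. g x * \<xi> 0 z)"
      by (intro add fine_cont_mult fine_cont_diff g(1) \<xi>_cont fine_cont_const)
    ultimately show ?thesis by (simp add: scale[OF \<xi>_cont])
  qed
  then show ?thesis unfolding represented_near_def using \<eta>(1)
    by (intro exI[of _ "\<eta> / 2"] conjI exI[of _ "{x}"] exI[of _ "\<lambda>_. \<Phi> (\<xi> 0)"]) auto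
qed

text \<open>Concatenate the local representations; a function vanishing outside the unit interval is
  supported within any margin of it.\<close>

theorem represented_on_unit_interval:
  "\<exists>A c. finite A \<and> A \<subseteq> {0..1} \<and>
     (\<forall>g. fine_cont g \<and> (\<forall>z. z \<notin> {0..1} \<longrightarrow> g z = 0) \<longrightarrow> \<Phi> g = (\<Sum>x\<in>A. c x * g x))"
proof -
  have "represented_near {0..1} x x" if "0 \<le> x" "x \<le> 1" for x
    using represented_near_mono[OF represented_near_point[of x]] that by simp
  then have near: "represented_near {0..1} 0 1" by (rule represented_near_interval[rotated]) auto
  obtain \<eta> A c where *: "\<eta> > 0" "finite A" "A \<subseteq> {0..1}"
    "\<And>g. fine_cont g \<Longrightarrow> (\<And>z. g z \<noteq> 0 \<Longrightarrow> 0 - \<eta> < z \<and> z < 1 + \<eta>) \<Longrightarrow> \<Phi> g = (\<Sum>x\<in>A. c x * g x)"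
    using represented_nearE[OF near] by blast
  have "\<Phi> g = (\<Sum>x\<in>A. c x * g x)" if "fine_cont g" "\<And>z. z \<notin> {0..1} \<Longrightarrow> g z = 0" for g
  proof (rule *(4)[OF that(1)])
    fix z assume "g z \<noteq> 0"
    then have "z \<in> {0..1}" using that(2) by blast
    then show "0 - \<eta> < z \<and> z < 1 + \<eta>" using *(1) by auto
  qed
  then show ?thesis using *(2,3) by blast
qed

end

section \<open>Bases of duals\<close>

text \<open>An elementary form of \<open>free_abelian_on\<close> for duals: finite sets with
  coefficient functions replace finitely supported mappings, and all equations are pointwise on the
  carrier.\<close>

definition dual_basis :: "('a, 'm) monoid_scheme \<Rightarrow> 'i set \<Rightarrow> ('i \<Rightarrow> 'a \<Rightarrow> int) \<Rightarrow> bool" where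
  "dual_basis G I b \<longleftrightarrow>
     (\<forall>i\<in>I. b i \<in> carrier (dual_group G)) \<and>
     (\<forall>A c. finite A \<longrightarrow> A \<subseteq> I \<longrightarrow> (\<forall>g\<in>carrier G. (\<Sum>i\<in>A. c i * b i g) = 0) \<longrightarrow> (\<forall>i\<in>A. c i = 0)) \<and>
     (\<forall>\<phi>\<in>hom G integer_group. \<exists>A c. finite A \<and> A \<subseteq> I \<and> (\<forall>g\<in>carrier G. \<phi> g = (\<Sum>i\<in>A. c i * b i g)))"

lemma dual_basis_closed: "dual_basis G I b \<Longrightarrow> i \<in> I \<Longrightarrow> b i \<in> carrier (dual_group G)"
  by (simp add: dual_basis_def)

lemma dual_basis_independent:
  assumes "dual_basis G I b" "finite A" "A \<subseteq> I"
    "\<And>g. g \<in> carrier G \<Longrightarrow> (\<Sum>i\<in>A. c i * b i g) = 0" "i \<in> A"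
  shows "c i = 0"
proof -
  from assms(1) have "\<forall>A c. finite A \<longrightarrow> A \<subseteq> I \<longrightarrow>
      (\<forall>g\<in>carrier G. (\<Sum>i\<in>A. c i * b i g) = 0) \<longrightarrow> (\<forall>i\<in>A. c i = 0)"
    unfolding dual_basis_def by (elim conjE)
  from this[rule_format, OF assms(2,3,4,5)] show ?thesis .
qed

lemma dual_basis_span:
  assumes "dual_basis G I b" "\<phi> \<in> hom G integer_group"
  obtains A c where "finite A" "A \<subseteq> I" "\<And>g. g \<in> carrier G \<Longrightarrow> \<phi> g = (\<Sum>i\<in>A. c i * b i g)"
proof -
  from assms(1) have "\<forall>\<phi>\<in>hom G integer_group. \<exists>A c. finite A \<and> A \<subseteq> I \<and>
      (\<forall>g\<in>carrier G. \<phi> g = (\<Sum>i\<in>A. c i * b i g))"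
    unfolding dual_basis_def by (elim conjE)
  from bspec[OF this assms(2)] obtain A c where A: "finite A" "A \<subseteq> I"
    "\<forall>g\<in>carrier G. \<phi> g = (\<Sum>i\<in>A. c i * b i g)"
    by (elim exE conjE)
  show thesis by (rule that[OF A(1,2)]) (use A(3) in simp)
qed

lemma carrier_dual_group: "carrier (dual_group G) = hom G integer_group \<inter> extensional (carrier G)"
  by (simp add: dual_group_def)

lemma hom_integer_group_mult:
  "\<phi> \<in> hom G integer_group \<Longrightarrow> g \<in> carrier G \<Longrightarrow> h \<in> carrier G \<Longrightarrow> \<phi> (g \<otimes>\<^bsub>G\<^esub> h) = \<phi> g + \<phi> h"
  by (simp add: hom_mult)

lemma sum_keys_eq:
  fixes p :: "'i \<Rightarrow>\<^sub>0 int"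
  assumes "finite A" "Poly_Mapping.keys p \<subseteq> A"
  shows "(\<Sum>i\<in>Poly_Mapping.keys p. Poly_Mapping.lookup p i * h i) = (\<Sum>i\<in>A. Poly_Mapping.lookup p i * h i)"
  using assms by (intro sum.mono_neutral_left) (auto simp: in_keys_iff)

text \<open>\<open>\<Lambda>\<close> evaluates formal combinations; independence makes it injective
  and spanning makes it surjective.\<close>

lemma free_abelian_on_dual_group:
  fixes b :: "'i \<Rightarrow> 'a \<Rightarrow> int"
  assumes G: "group G" and b: "dual_basis G I b"
  shows "free_abelian_on (dual_group G) I b"
proof -
  interpret group G by fact
  define \<Lambda> where "\<Lambda> p = (\<lambda>g\<in>carrier G. \<Sum>i\<in>Poly_Mapping.keys p. Poly_Mapping.lookup p i * b i g)"
    for p :: "'i \<Rightarrow>\<^sub>0 int"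
  have b_hom: "b i \<in> hom G integer_group" "b i \<in> extensional (carrier G)" if "i \<in> I" for i
    using dual_basis_closed[OF b that] by (auto simp: carrier_dual_group)
  \<comment> \<open>Any finite superset of the keys may serve as index set, so sums for different
    mappings can be compared termwise.\<close>
  have \<Lambda>_eq: "\<Lambda> p = (\<lambda>g\<in>carrier G. \<Sum>i\<in>A. Poly_Mapping.lookup p i * b i g)"
    if "finite A" "Poly_Mapping.keys p \<subseteq> A" for p A
    unfolding \<Lambda>_def sum_keys_eq[OF that] ..
  have "\<Lambda> \<in> iso (free_Abelian_group I) (dual_group G)"
    unfolding iso_def bij_betw_def
  proof (intro CollectI conjI)
    show "\<Lambda> \<in> hom (free_Abelian_group I) (dual_group G)"
    proof (rule homI)
      fix p assume "p \<in> carrier (free_Abelian_group I)"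
      then have "\<Lambda> p \<in> hom G integer_group"
        by (intro homI) (auto simp: \<Lambda>_def hom_integer_group_mult[OF b_hom(1)] subset_iff
            distrib_left sum.distrib intro!: sum.cong)
      then show "\<Lambda> p \<in> carrier (dual_group G)" by (simp add: carrier_dual_group \<Lambda>_def)
    next
      fix p q assume "p \<in> carrier (free_Abelian_group I)" "q \<in> carrier (free_Abelian_group I)"
      define A where "A = Poly_Mapping.keys p \<union> Poly_Mapping.keys q"
      have A: "finite A" "Poly_Mapping.keys p \<subseteq> A" "Poly_Mapping.keys q \<subseteq> A" "Poly_Mapping.keys (p + q) \<subseteq> A"
        using Poly_Mapping.keys_add[of p q] by (auto simp: A_def)
      show "\<Lambda> (p \<otimes>\<^bsub>free_Abelian_group I\<^esub> q) = \<Lambda> p \<otimes>\<^bsub>dual_group G\<^esub> \<Lambda> q"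
        unfolding mult_free_Abelian_group \<Lambda>_eq[OF A(1,2)] \<Lambda>_eq[OF A(1,3)] \<Lambda>_eq[OF A(1,4)]
        by (auto simp: dual_group_def lookup_add distrib_right sum.distrib)
    qed
    show "inj_on \<Lambda> (carrier (free_Abelian_group I))"
    proof (rule inj_onI)
      fix p q assume pq: "p \<in> carrier (free_Abelian_group I)" "q \<in> carrier (free_Abelian_group I)" "\<Lambda> p = \<Lambda> q"
      define A where "A = Poly_Mapping.keys p \<union> Poly_Mapping.keys q"
      have A: "finite A" "Poly_Mapping.keys p \<subseteq> A" "Poly_Mapping.keys q \<subseteq> A" "A \<subseteq> I"
        using pq by (auto simp: A_def)
      have "(\<Sum>i\<in>A. (Poly_Mapping.lookup p i - Poly_Mapping.lookup q i) * b i g) = 0" if "g \<in> carrier G" for g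
        using fun_cong[OF pq(3), of g] that
        unfolding \<Lambda>_eq[OF A(1,2)] \<Lambda>_eq[OF A(1,3)] by (simp add: left_diff_distrib sum_subtractf)
      from dual_basis_independent[OF b A(1,4) this]
      have "Poly_Mapping.lookup p i = Poly_Mapping.lookup q i" if "i \<in> A" for i
        using that by fastforce
      moreover have "Poly_Mapping.lookup p i = Poly_Mapping.lookup q i" if "i \<notin> A" for i
        using that by (auto simp: A_def in_keys_iff)
      ultimately show "p = q" by (intro poly_mapping_eqI) blast
    qed
    show "\<Lambda> ` carrier (free_Abelian_group I) = carrier (dual_group G)"
    proof
      show "\<Lambda> ` carrier (free_Abelian_group I) \<subseteq> carrier (dual_group G)"
        using \<open>\<Lambda> \<in> hom _ _\<close> by (auto simp: hom_def)
      show "carrier (dual_group G) \<subseteq> \<Lambda> ` carrier (free_Abelian_group I)"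
      proof
        fix \<phi> assume \<phi>: "\<phi> \<in> carrier (dual_group G)"
        then have "\<phi> \<in> hom G integer_group" by (simp add: carrier_dual_group)
        then obtain A c where A: "finite A" "A \<subseteq> I" "\<And>g. g \<in> carrier G \<Longrightarrow> \<phi> g = (\<Sum>i\<in>A. c i * b i g)"
          using dual_basis_span[OF b] by blast
        define p where "p = Abs_poly_mapping (\<lambda>i. if i \<in> A then c i else 0)"
        have lookup: "Poly_Mapping.lookup p i = (if i \<in> A then c i else 0)" for i
          unfolding p_def using A(1) by (subst Abs_poly_mapping_inverse) (auto intro: rev_finite_subset)
        have keys: "Poly_Mapping.keys p \<subseteq> A" by (auto simp: in_keys_iff lookup split: if_splits)
        have "\<phi> = \<Lambda> p"
          unfolding \<Lambda>_eq[OF A(1) keys]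
        proof (rule extensionalityI)
          show "\<phi> \<in> extensional (carrier G)" using \<phi> by (simp add: carrier_dual_group)
        qed (use A in \<open>auto simp: lookup intro!: sum.cong\<close>)
        then show "\<phi> \<in> \<Lambda> ` carrier (free_Abelian_group I)" using keys A(2) by auto
      qed
    qed
  qed
  moreover have "\<Lambda> (frag_of i) = b i" if "i \<in> I" for i
    by (rule extensionalityI[OF _ b_hom(2)[OF that]]) (auto simp: \<Lambda>_def)
  ultimately show ?thesis unfolding free_abelian_on_def by blast
qed

text \<open>Bases of duals are transported by composing with the inverse isomorphism, which turns
  \<open>eval_hom\<close> into \<open>eval_hom_rat\<close> when \<open>\<psi>\<close> is
  \<open>restr_rat\<close>.\<close>

lemma dual_basis_iso:
  assumes G: "group G" and \<psi>: "\<psi> \<in> iso G H" and b: "dual_basis G I b"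
  shows "dual_basis H I (\<lambda>i. \<lambda>f\<in>carrier H. b i (inv_into (carrier G) \<psi> f))"
proof -
  interpret group G by fact
  define \<theta> where "\<theta> = inv_into (carrier G) \<psi>"
  have \<psi>_hom: "\<psi> \<in> hom G H" and bij: "bij_betw \<psi> (carrier G) (carrier H)"
    using \<psi> by (auto simp: iso_def)
  have "\<theta> \<in> iso H G" unfolding \<theta>_def by (rule iso_set_sym[OF \<psi>])
  then have \<theta>_hom: "\<theta> \<in> hom H G" by (simp add: iso_def)
  have \<theta>: "\<And>g. g \<in> carrier G \<Longrightarrow> \<theta> (\<psi> g) = g" "\<And>f. f \<in> carrier H \<Longrightarrow> \<psi> (\<theta> f) = f"
    "\<And>g. g \<in> carrier G \<Longrightarrow> \<psi> g \<in> carrier H" "\<And>f. f \<in> carrier H \<Longrightarrow> \<theta> f \<in> carrier G"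
    using bij \<theta>_hom \<psi>_hom unfolding \<theta>_def hom_def
    by (auto simp: bij_betw_inv_into_left bij_betw_inv_into_right)
  have closed: "f \<otimes>\<^bsub>H\<^esub> f' \<in> carrier H" if "f \<in> carrier H" "f' \<in> carrier H" for f f'
    using \<theta>(3)[OF m_closed[OF \<theta>(4)[OF that(1)] \<theta>(4)[OF that(2)]]] hom_mult[OF \<psi>_hom \<theta>(4)[OF that(1)] \<theta>(4)[OF that(2)]]
      that by (simp add: \<theta>(2))
  show ?thesis
    unfolding dual_basis_def \<theta>_def[symmetric]
  proof (intro conjI ballI allI impI)
    fix i assume "i \<in> I"
    then have "b i \<in> hom G integer_group"
      using dual_basis_closed[OF b] by (auto simp: carrier_dual_group)
    then show "(\<lambda>f\<in>carrier H. b i (\<theta> f)) \<in> carrier (dual_group H)"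
      unfolding carrier_dual_group
      by (auto intro!: homI simp: closed hom_mult[OF \<theta>_hom] hom_integer_group_mult \<theta>(4))
  next
    fix A c i
    assume A: "finite A" "A \<subseteq> I" "\<forall>f\<in>carrier H. (\<Sum>i\<in>A. c i * (\<lambda>f\<in>carrier H. b i (\<theta> f)) f) = 0" "i \<in> A"
    have "(\<Sum>i\<in>A. c i * b i g) = 0" if "g \<in> carrier G" for g
      using A(3)[rule_format, OF \<theta>(3)[OF that]] by (simp add: \<theta>(1,3) that)
    then show "c i = 0" by (rule dual_basis_independent[OF b A(1,2) _ A(4)])
  next
    fix \<phi> assume \<phi>: "\<phi> \<in> hom H integer_group"
    have "\<phi> \<circ> \<psi> \<in> hom G integer_group"
      by (rule homI) (simp_all add: hom_mult[OF \<psi>_hom] hom_integer_group_mult[OF \<phi>] \<theta>(3))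
    then obtain A c where A: "finite A" "A \<subseteq> I" "\<And>g. g \<in> carrier G \<Longrightarrow> (\<phi> \<circ> \<psi>) g = (\<Sum>i\<in>A. c i * b i g)"
      using dual_basis_span[OF b] by blast
    have "\<phi> f = (\<Sum>i\<in>A. c i * (\<lambda>f\<in>carrier H. b i (\<theta> f)) f)" if "f \<in> carrier H" for f
      using A(3)[OF \<theta>(4)[OF that]] that by (simp add: \<theta>(2))
    then show "\<exists>A c. finite A \<and> A \<subseteq> I \<and> (\<forall>f\<in>carrier H. \<phi> f = (\<Sum>i\<in>A. c i * (\<lambda>f\<in>carrier H. b i (\<theta> f)) f))"
      using A(1,2) by blast
  qed
qed

lemma dual_basis_inj_on:
  assumes "dual_basis G I b"
  shows "inj_on b I"
proof (rule inj_onI, rule ccontr)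
  fix i j assume ij: "i \<in> I" "j \<in> I" "b i = b j" "i \<noteq> j"
  \<comment> \<open>Coefficients 1 at \<open>i\<close> and -1 at \<open>j\<close> give a vanishing
    combination if \<open>b i = b j\<close>; the term is that coefficient function at
    \<open>i\<close>.\<close>
  have "(if i = i then 1 else -1 :: int) = 0"
    by (rule dual_basis_independent[OF assms, of "{i, j}" "\<lambda>k. if k = i then 1 else -1" i]) (use ij in auto)
  then show False by simp
qed

text \<open>Indexing the basis by itself exhibits it as a set, whose cardinality is the
  rank.\<close>

lemma dual_basis_image:
  assumes b: "dual_basis G I b"
  shows "dual_basis G (b ` I) (\<lambda>\<phi>. \<phi>)"
proof -
  note inj = dual_basis_inj_on[OF b]
  show ?thesis
    unfolding dual_basis_def
  proof (intro conjI ballI allI impI)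
    fix \<phi> assume "\<phi> \<in> b ` I"
    then show "\<phi> \<in> carrier (dual_group G)" using dual_basis_closed[OF b] by blast
  next
    fix A c \<phi>
    assume A: "finite A" "A \<subseteq> b ` I" "\<forall>g\<in>carrier G. (\<Sum>\<phi>\<in>A. c \<phi> * \<phi> g) = 0" "\<phi> \<in> A"
    then obtain C where C: "C \<subseteq> I" "finite C" "A = b ` C" by (meson finite_subset_image)
    then obtain i where i: "i \<in> C" "\<phi> = b i" using A(4) by blast
    have "(\<Sum>i\<in>C. c (b i) * b i g) = 0" if "g \<in> carrier G" for g
      using A(3)[rule_format, OF that] sum.reindex[OF inj_on_subset[OF inj C(1)], of "\<lambda>\<phi>. c \<phi> * \<phi> g"]
      by (simp add: C(3) o_def)
    then show "c \<phi> = 0" unfolding i(2) by (rule dual_basis_independent[OF b C(2,1) _ i(1)])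
  next
    fix \<phi> assume "\<phi> \<in> hom G integer_group"
    then obtain A c where A: "finite A" "A \<subseteq> I" "\<And>g. g \<in> carrier G \<Longrightarrow> \<phi> g = (\<Sum>i\<in>A. c i * b i g)"
      using dual_basis_span[OF b] by blast
    have "\<phi> g = (\<Sum>\<phi>\<in>b ` A. c (inv_into I b \<phi>) * \<phi> g)" if "g \<in> carrier G" for g
      unfolding A(3)[OF that] sum.reindex[OF inj_on_subset[OF inj A(2)]] o_def
      using A(2) inj by (intro sum.cong) (auto simp: inv_into_f_f subset_iff)
    then show "\<exists>A c. finite A \<and> A \<subseteq> b ` I \<and> (\<forall>g\<in>carrier G. \<phi> g = (\<Sum>\<phi>\<in>A. c \<phi> * \<phi> g))"
      using A(1,2) by (intro exI[of _ "b ` A"] exI[of _ "c \<circ> inv_into I b"]) auto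
  qed
qed

section \<open>The evaluations form a basis of the dual\<close>

lemma carrier_fine_group: "g \<in> carrier fine_group \<longleftrightarrow> g \<in> extensional {0..1} \<and> fine_cont g"
  by (auto simp: fine_group_def int_power_def PiE_def)

lemma mult_fine_group: "f \<otimes>\<^bsub>fine_group\<^esub> g = (\<lambda>x\<in>{0..1}. f x + g x)"
  by (simp add: fine_group_def int_power_def product_group_def)

lemma group_fine_group: "group fine_group"
proof -
  have "group (int_power {0..1} \<lparr>carrier := carrier fine_group\<rparr>)"
    by (rule subgroup.subgroup_is_group[OF subgroup_fine_group]) (simp add: int_power_def)
  then show ?thesis by (simp add: fine_group_def)
qed

lemma restrict_in_fine_group:
  assumes "fine_cont g"
  shows "restrict g {0..1} \<in> carrier fine_group"
proof -
  have "fine_cont (restrict g {0..1})"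
    by (rule continuous_map_eq[OF assms]) (simp add: topspace_fine_topology)
  then show ?thesis by (simp add: carrier_fine_group)
qed

text \<open>Take the indicator of a rational interval around \<open>x\<close> that excludes the
  other points of \<open>A\<close>.\<close>

lemma fine_cont_separates:
  assumes "finite A"
  shows "\<exists>g. fine_cont g \<and> g x = 1 \<and> (\<forall>y\<in>A - {x}. g y = 0)"
proof -
  obtain d where d: "d > 0" "\<And>y. y \<in> A \<Longrightarrow> y \<noteq> x \<Longrightarrow> d \<le> dist x y"
    using finite_set_avoid[OF assms, of x] by blast
  obtain u where u: "u \<in> \<rat>" "x - d < u" "u < x" using Rats_dense_in_real[of "x - d" x] d(1) by auto
  obtain v where v: "v \<in> \<rat>" "x < v" "v < x + d" using Rats_dense_in_real[of x "x + d"] d(1) by auto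
  have "\<not> (u < y \<and> y \<le> v)" if "y \<in> A - {x}" for y
    using d(2)[of y] that u v by (auto simp: dist_real_def)
  then show ?thesis
    using u v by (intro exI[of _ "\<lambda>z. if u < z \<and> z \<le> v then 1 else 0"] conjI fine_cont_rational_interval) auto
qed

theorem dual_basis_fine_group: "dual_basis fine_group {0..1} eval_hom"
  unfolding dual_basis_def
proof (intro conjI ballI allI impI)
  fix x :: real assume "x \<in> {0..1}"
  interpret group fine_group by (rule group_fine_group)
  have "eval_hom x (f \<otimes>\<^bsub>fine_group\<^esub> g) = eval_hom x f + eval_hom x g"
    if "f \<in> carrier fine_group" "g \<in> carrier fine_group" for f g
    using that m_closed[OF that] \<open>x \<in> {0..1}\<close> by (simp add: eval_hom_def mult_fine_group)
  then show "eval_hom x \<in> carrier (dual_group fine_group)"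
    by (auto simp: carrier_dual_group eval_hom_def intro!: homI)
next
  fix A and c :: "real \<Rightarrow> int" and x
  assume A: "finite A" "A \<subseteq> {0..1}" "\<forall>g\<in>carrier fine_group. (\<Sum>x\<in>A. c x * eval_hom x g) = 0" "x \<in> A"
  obtain g where g: "fine_cont g" "g x = 1" "\<forall>y\<in>A - {x}. g y = 0"
    using fine_cont_separates[OF A(1)] by blast
  note mem = restrict_in_fine_group[OF g(1)]
  have "0 = (\<Sum>y\<in>A. c y * eval_hom y (restrict g {0..1}))" using A(3) mem by simp
  also have "\<dots> = (\<Sum>y\<in>A. if y = x then c x else 0)"
    using A(2) g mem by (intro sum.cong) (auto simp: eval_hom_def)
  also have "\<dots> = c x" using A(1,4) by simp
  finally show "c x = 0" by simp
next
  fix \<phi> assume \<phi>: "\<phi> \<in> hom fine_group integer_group"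
  interpret fine_functional "\<lambda>g. \<phi> (restrict g {0..1})"
  proof
    fix f g assume fg: "fine_cont f" "fine_cont g"
    have "restrict (\<lambda>z. f z + g z) {0..1} = restrict f {0..1} \<otimes>\<^bsub>fine_group\<^esub> restrict g {0..1}"
      by (auto simp: mult_fine_group)
    then show "\<phi> (restrict (\<lambda>z. f z + g z) {0..1}) = \<phi> (restrict f {0..1}) + \<phi> (restrict g {0..1})"
      using hom_integer_group_mult[OF \<phi> restrict_in_fine_group[OF fg(1)] restrict_in_fine_group[OF fg(2)]] by simp
  qed
  from represented_on_unit_interval obtain A c where A: "finite A" "A \<subseteq> {0..1}"
    "\<forall>g. fine_cont g \<and> (\<forall>z. z \<notin> {0..1} \<longrightarrow> g z = 0) \<longrightarrow> \<phi> (restrict g {0..1}) = (\<Sum>x\<in>A. c x * g x)"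
    by (elim exE conjE)
  have "\<phi> g = (\<Sum>x\<in>A. c x * eval_hom x g)" if g: "g \<in> carrier fine_group" for g
  proof -
    \<comment> \<open>Elements of \<open>fine_group\<close> are \<open>undefined\<close> outside the
      unit interval; the representation requires the value 0 there.\<close>
    define h where "h z = (if z \<in> {0..1} then g z else 0)" for z
    have "fine_cont h"
      using g by (intro continuous_map_eq[of _ _ g h]) (auto simp: carrier_fine_group topspace_fine_topology h_def)
    then have "\<phi> (restrict h {0..1}) = (\<Sum>x\<in>A. c x * h x)"
      by (intro A(3)[rule_format]) (simp add: h_def)
    moreover have "restrict h {0..1} = g"
      using g by (auto simp: h_def carrier_fine_group extensional_def)
    moreover have "(\<Sum>x\<in>A. c x * h x) = (\<Sum>x\<in>A. c x * eval_hom x g)"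
      using A(2) g by (intro sum.cong) (auto simp: h_def eval_hom_def)
    ultimately show ?thesis by simp
  qed
  then show "\<exists>A c. finite A \<and> A \<subseteq> {0..1} \<and> (\<forall>g\<in>carrier fine_group. \<phi> g = (\<Sum>x\<in>A. c x * eval_hom x g))"
    using A(1,2) by blast
qed

section \<open>Restriction to the rationals\<close>

text \<open>A thick set contains a rational interval close to \<open>x\<close>, hence its endpoints.
  Loss 1/2 already forces a nonempty family.\<close>

lemma thick_at_meets_rationals:
  assumes "thick_at x U" "x \<in> {0..1}" "x \<notin> \<rat>"
  shows "\<exists>q\<in>\<rat> \<inter> {0..1}. q \<in> U"
proof -
  have "(1/2 :: real) > 0" by simp
  from assms(1)[unfolded thick_at_def, rule_format, OF this] obtain \<delta> where \<delta>: "\<delta> > 0"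
    "\<And>r s. r \<in> \<rat> \<and> s \<in> \<rat> \<and> {r..s} \<subseteq> {0..1} \<and> x \<in> {r..s} \<and> s - r < \<delta> \<Longrightarrow>
      \<exists>F. rational_interval_family (U \<inter> {r..s}) F \<and> total_length F \<ge> (1 - 1/2) * (s - r)"
    by blast
  have "x \<noteq> 0" "x \<noteq> 1" using assms(3) by auto
  then have x: "0 < x" "x < 1" using assms(2) by auto
  obtain r where r: "r \<in> \<rat>" "max 0 (x - \<delta> / 2) < r" "r < x"
    using Rats_dense_in_real[of "max 0 (x - \<delta> / 2)" x] x \<delta>(1) by auto
  obtain s where s: "s \<in> \<rat>" "x < s" "s < min 1 (x + \<delta> / 2)"
    using Rats_dense_in_real[of x "min 1 (x + \<delta> / 2)"] x \<delta>(1) by auto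
  obtain F where F: "rational_interval_family (U \<inter> {r..s}) F" "total_length F \<ge> (1 - 1/2) * (s - r)"
    using \<delta>(2)[of r s] r s by auto
  have "F \<noteq> {}" using F(2) r s by (auto simp: total_length_def)
  then obtain a b where "(a, b) \<in> F" by auto
  then have "a \<in> \<rat>" "a \<le> b" "{a..b} \<subseteq> U \<inter> {r..s}"
    using F(1) unfolding rational_interval_family_def by auto
  then have "a \<in> \<rat>" "a \<in> U" "a \<in> {r..s}" by auto
  then show ?thesis using r s by (intro bexI[of _ a]) auto
qed

text \<open>For injectivity, the level set of \<open>f - g\<close> through an irrational point is
  thick, so it meets the rationals, where \<open>f - g\<close> is 0.\<close>

lemma restr_rat_iso: "restr_rat \<in> iso fine_group fine_group_rat"
  unfolding iso_def bij_betw_def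
proof (intro CollectI conjI)
  show "restr_rat \<in> hom fine_group fine_group_rat"
    by (rule homI) (auto simp: fine_group_rat_def mult_fine_group restr_rat_def int_power_def product_group_def)
  show "restr_rat ` carrier fine_group = carrier fine_group_rat" by (simp add: fine_group_rat_def)
  show "inj_on restr_rat (carrier fine_group)"
  proof (rule inj_onI)
    fix f g assume fg: "f \<in> carrier fine_group" "g \<in> carrier fine_group" "restr_rat f = restr_rat g"
    have rat: "f q = g q" if "q \<in> \<rat> \<inter> {0..1}" for q
      using fun_cong[OF fg(3), of q] that by (simp add: restr_rat_def)
    have "f x = g x" if x: "x \<in> {0..1}" for x
    proof (cases "x \<in> \<rat>")
      case False
      have "fine_cont (\<lambda>z. f z - g z)" using fg by (intro fine_cont_diff) (auto simp: carrier_fine_group)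
      then have "thick_at x {y. f y - g y = f x - g x}" using False by (simp add: fine_cont_iff)
      then obtain q where "q \<in> \<rat> \<inter> {0..1}" "f q - g q = f x - g x"
        using thick_at_meets_rationals[OF _ x False] by blast
      then show ?thesis using rat by simp
    qed (use rat x in auto)
    then show "f = g" using fg(1,2) by (intro extensionalityI[of f "{0..1}" g]) (auto simp: carrier_fine_group)
  qed
qed

lemma group_fine_group_rat: "group fine_group_rat"
proof -
  have "group (int_power ({0..1} \<inter> \<rat>) \<lparr>carrier := carrier fine_group_rat\<rparr>)"
    by (rule subgroup.subgroup_is_group[OF subgroup_fine_group_rat]) (simp add: int_power_def)
  then show ?thesis by (simp add: fine_group_rat_def)
qed

lemma dual_basis_fine_group_rat: "dual_basis fine_group_rat {0..1} eval_hom_rat"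
  using dual_basis_iso[OF group_fine_group restr_rat_iso dual_basis_fine_group]
  by (simp add: eval_hom_rat_def[abs_def])

section \<open>Embedding into the countable power and the rank of the dual\<close>

lemma infinite_unit_interval_rationals: "infinite ({0..1} \<inter> \<rat> :: real set)"
proof -
  have "inj (\<lambda>n. 1 / real (Suc n))" by (rule injI) simp
  then have "infinite (range (\<lambda>n. 1 / real (Suc n)))" by (rule range_inj_infinite)
  moreover have "range (\<lambda>n. 1 / real (Suc n)) \<subseteq> {0..1} \<inter> \<rat>" by auto
  ultimately show ?thesis using finite_subset by blast
qed

lemma unit_interval_eqpoll_nat_sets: "{0..1::real} \<approx> (UNIV :: nat set set)"
proof (rule lepoll_antisym)
  have "{0..1::real} \<lesssim> (UNIV :: real set)" by (simp add: subset_imp_lepoll)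
  then show "{0..1::real} \<lesssim> (UNIV :: nat set set)"
    using nat_sets_eqpoll_reals eqpoll_sym lepoll_trans1 lepoll_trans eqpoll_imp_lepoll by blast
  have "{0..<1::real} \<lesssim> {0..1::real}" by (rule subset_imp_lepoll) auto
  then show "(UNIV :: nat set set) \<lesssim> {0..1::real}"
    using nat_sets_lepoll_reals01 lepoll_trans by blast
qed

text \<open>Relabel the coordinates along an enumeration of the rationals in the unit
  interval.\<close>

lemma int_power_subgroup_iso_fine_group_rat:
  "\<exists>H \<psi>. subgroup H (int_power (UNIV :: nat set)) \<and>
     \<psi> \<in> iso fine_group_rat ((int_power UNIV)\<lparr>carrier := H\<rparr>)"
proof -
  define Q where "Q = ({0..1} \<inter> \<rat> :: real set)"
  have "countable Q" unfolding Q_def by (simp add: countable_rat countable_Int2)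
  then obtain e where e: "bij_betw e (UNIV :: nat set) Q"
    using infinite_unit_interval_rationals bij_betw_from_nat_into unfolding Q_def by blast
  define \<psi> :: "(real \<Rightarrow> int) \<Rightarrow> nat \<Rightarrow> int" where "\<psi> f = f \<circ> e" for f
  define H where "H = \<psi> ` carrier fine_group_rat"
  have e_mem: "e n \<in> Q" for n using e by (auto simp: bij_betw_def)
  have hom: "\<psi> \<in> hom (int_power Q) (int_power UNIV)"
    by (rule homI) (auto simp: \<psi>_def int_power_def product_group_def e_mem)
  have sub: "subgroup (carrier fine_group_rat) (int_power Q)"
    using subgroup_fine_group_rat by (simp add: Q_def)
  have "group_hom (int_power Q) (int_power UNIV) \<psi>"
    using hom by (simp add: group_hom_def group_hom_axioms_def int_power_def)
  then have H: "subgroup H (int_power UNIV)"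
    unfolding H_def using sub by (rule group_hom.subgroup_img_is_subgroup)
  have ext: "carrier fine_group_rat \<subseteq> extensional Q"
    using subgroup.subset[OF sub] by (auto simp: int_power_def PiE_def)
  have "inj_on \<psi> (carrier fine_group_rat)"
  proof (rule inj_onI)
    fix f g assume fg: "f \<in> carrier fine_group_rat" "g \<in> carrier fine_group_rat" "\<psi> f = \<psi> g"
    have "f q = g q" if "q \<in> Q" for q
    proof -
      have "q \<in> range e" using that e by (simp add: bij_betw_def)
      then obtain n where "q = e n" by blast
      then show ?thesis using fun_cong[OF fg(3), of n] by (simp add: \<psi>_def)
    qed
    then show "f = g" using fg(1,2) ext by (intro extensionalityI[of f Q g]) auto
  qed
  moreover have "\<psi> \<in> hom fine_group_rat ((int_power UNIV)\<lparr>carrier := H\<rparr>)"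
  proof (rule homI)
    fix f g assume "f \<in> carrier fine_group_rat" "g \<in> carrier fine_group_rat"
    then have "f \<in> carrier (int_power Q)" "g \<in> carrier (int_power Q)" using subgroup.subset[OF sub] by auto
    then show "\<psi> (f \<otimes>\<^bsub>fine_group_rat\<^esub> g) = \<psi> f \<otimes>\<^bsub>(int_power UNIV)\<lparr>carrier := H\<rparr>\<^esub> \<psi> g"
      using hom_mult[OF hom, of f g] by (simp add: fine_group_rat_def Q_def)
  qed (simp add: H_def)
  ultimately have "\<psi> \<in> iso fine_group_rat ((int_power UNIV)\<lparr>carrier := H\<rparr>)"
    by (simp add: iso_def bij_betw_def H_def)
  then show ?thesis using H by blast
qed

theorem corollary10:
  shows
    "free_abelian_on (dual_group fine_group) {0..1} eval_hom \<and>
     (restr_rat \<in> iso fine_group fine_group_rat \<and>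
      free_abelian_on (dual_group fine_group_rat) {0..1} eval_hom_rat) \<and>
     (\<exists>H. subgroup H (int_power (UNIV :: nat set)) \<and>
        (\<exists>B. B \<approx> (UNIV :: nat set set) \<and>
           free_abelian_on (dual_group ((int_power (UNIV :: nat set))\<lparr>carrier := H\<rparr>)) B (\<lambda>b. b)))"
proof (intro conjI)
  show "free_abelian_on (dual_group fine_group) {0..1} eval_hom"
    by (intro free_abelian_on_dual_group group_fine_group dual_basis_fine_group)
  show "restr_rat \<in> iso fine_group fine_group_rat" by (rule restr_rat_iso)
  show "free_abelian_on (dual_group fine_group_rat) {0..1} eval_hom_rat"
    by (intro free_abelian_on_dual_group group_fine_group_rat dual_basis_fine_group_rat)
  obtain H \<psi> where H: "subgroup H (int_power (UNIV :: nat set))"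
    and \<psi>: "\<psi> \<in> iso fine_group_rat ((int_power UNIV)\<lparr>carrier := H\<rparr>)"
    using int_power_subgroup_iso_fine_group_rat by blast
  have grp: "group ((int_power UNIV)\<lparr>carrier := H\<rparr>)"
    by (rule subgroup.subgroup_is_group[OF H]) (simp add: int_power_def)
  define b where "b = (\<lambda>x. \<lambda>f\<in>carrier ((int_power UNIV)\<lparr>carrier := H\<rparr>).
      eval_hom_rat x (inv_into (carrier fine_group_rat) \<psi> f))"
  have b: "dual_basis ((int_power UNIV)\<lparr>carrier := H\<rparr>) {0..1} b"
    unfolding b_def by (rule dual_basis_iso[OF group_fine_group_rat \<psi> dual_basis_fine_group_rat])
  \<comment> \<open>Distinct points give distinct basis elements, so the basis has the cardinality
    of the continuum.\<close>
  have "b ` {0..1} \<approx> {0..1::real}"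
    using dual_basis_inj_on[OF b] by (rule inj_on_image_eqpoll_self)
  then have "b ` {0..1} \<approx> (UNIV :: nat set set)"
    using unit_interval_eqpoll_nat_sets by (rule eqpoll_trans)
  then show "\<exists>H. subgroup H (int_power (UNIV :: nat set)) \<and>
      (\<exists>B. B \<approx> (UNIV :: nat set set) \<and>
         free_abelian_on (dual_group ((int_power (UNIV :: nat set))\<lparr>carrier := H\<rparr>)) B (\<lambda>b. b))"
    using H free_abelian_on_dual_group[OF grp dual_basis_image[OF b]] by blast
qed

end
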